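(* Let $A$ be a finite alphabet and let $M=\langle A\mid u=v\rangle$ be an incompressible one-relator monoid with $u,v\in A^+$; that is, there is no nonempty word $r\in A^+$ such that $u,v\in A^*r\cap rA^*$. Then $M$ is of type bi-$\mathrm{FP}_\infty$ and has Hochschild cohomological dimension at most $2$.
   Context: $A^*$ is the free monoid on $A$ and $A^+$ the set of nonempty words. $\langle A\mid u=v\rangle$ denotes the quotient of $A^*$ by the congruence generated by the pair $(u,v)$. $A^*r\cap rA^*$ is the set of words over $A$ having $r$ both as a suffix and as a prefix. $M^{op}$ is the opposite monoid of $M$; $\mathbb{Z}M$ is a left $\mathbb{Z}[M\times M^{op}]$-module via left and right multiplication. $M$ is of type bi-$\mathrm{FP}_\infty$ if the left $\mathbb{Z}[M\times M^{op}]$-module $\mathbb{Z}M$ has a projective resolution that is finitely generated in every degree. The Hochschild cohomological dimension of $M$ is the projective dimension of $\mathbb{Z}M$ as a left $\mathbb{Z}[M\times M^{op}]$-module. *)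

theory Defs
  imports
    "HOL-Algebra.Coset"
    "HOL-Algebra.Module"
    "HOL-Library.Poly_Mapping"
    "HOL-Library.Sublist"
    "HOL-Library.Extended_Nat"
begin

section \<open>Monoid presentations\<close>

inductive pres_cong :: "'a set \<Rightarrow> ('a list \<times> 'a list) set \<Rightarrow> 'a list \<Rightarrow> 'a list \<Rightarrow> bool"
  for A :: "'a set" and E :: "('a list \<times> 'a list) set"
where
  base: "(x, y) \<in> E \<Longrightarrow> x \<in> lists A \<Longrightarrow> y \<in> lists A \<Longrightarrow> pres_cong A E x y"
| refl: "x \<in> lists A \<Longrightarrow> pres_cong A E x x"
| sym: "pres_cong A E x y \<Longrightarrow> pres_cong A E y x"
| trans: "pres_cong A E x y \<Longrightarrow> pres_cong A E y z \<Longrightarrow> pres_cong A E x z"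
| mult: "pres_cong A E x y \<Longrightarrow> pres_cong A E x' y' \<Longrightarrow> pres_cong A E (x @ x') (y @ y')"

definition pres_class :: "'a set \<Rightarrow> ('a list \<times> 'a list) set \<Rightarrow> 'a list \<Rightarrow> 'a list set"
  where "pres_class A E w = {w'. pres_cong A E w w'}"

definition presented_monoid :: "'a set \<Rightarrow> ('a list \<times> 'a list) set \<Rightarrow> 'a list set monoid"
  where "presented_monoid A E =
    \<lparr> carrier = pres_class A E ` lists A,
      mult = (\<lambda>X Y. \<Union>x\<in>X. \<Union>y\<in>Y. pres_class A E (x @ y)),
      one = pres_class A E [] \<rparr>"

abbreviation one_relator_monoid :: "'a set \<Rightarrow> 'a list \<Rightarrow> 'a list \<Rightarrow> 'a list set monoid"
  where "one_relator_monoid A u v \<equiv> presented_monoid A {(u, v)}"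

definition incompressible :: "'a set \<Rightarrow> 'a list \<Rightarrow> 'a list \<Rightarrow> bool"
  where "incompressible A u v \<longleftrightarrow>
    \<not> (\<exists>r \<in> lists A. r \<noteq> [] \<and> {u, v} \<subseteq> {w \<in> lists A. suffix r w} \<inter> {w \<in> lists A. prefix r w})"

lemma pres_cong_lists:
  assumes "pres_cong A E x y" shows "x \<in> lists A \<and> y \<in> lists A"
  using assms by induction auto

lemma pres_class_eq_iff:
  assumes "x \<in> lists A"
  shows "pres_class A E x = pres_class A E y \<longleftrightarrow> pres_cong A E x y"
  unfolding pres_class_def using assms
  by (auto intro: pres_cong.refl pres_cong.sym pres_cong.trans)

lemma pres_class_mult:
  assumes "x \<in> lists A" "y \<in> lists A"
  shows "pres_class A E x \<otimes>\<^bsub>presented_monoid A E\<^esub> pres_class A E y = pres_class A E (x @ y)"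
proof -
  have "pres_class A E (x' @ y') = pres_class A E (x @ y)"
    if "x' \<in> pres_class A E x" "y' \<in> pres_class A E y" for x' y'
  proof -
    have "pres_cong A E (x @ y) (x' @ y')"
      using that by (auto simp: pres_class_def intro: pres_cong.mult)
    then show ?thesis by (metis pres_class_eq_iff pres_cong_lists)
  qed
  moreover have "x \<in> pres_class A E x" "y \<in> pres_class A E y"
    using assms by (auto simp: pres_class_def intro: pres_cong.refl)
  ultimately have "(\<Union>x'\<in>pres_class A E x. \<Union>y'\<in>pres_class A E y. pres_class A E (x' @ y')) = pres_class A E (x @ y)"
    by fast
  then show ?thesis by (simp add: presented_monoid_def)
qed

lemma monoid_presented_monoid: "monoid (presented_monoid A E)"
proof -
  have car: "carrier (presented_monoid A E) = pres_class A E ` lists A"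
    and one: "\<one>\<^bsub>presented_monoid A E\<^esub> = pres_class A E []"
    by (simp_all add: presented_monoid_def)
  show ?thesis
    by (rule monoidI; unfold car one; (elim imageE)?;
        simp only: pres_class_mult append_in_lists_conv lists.Nil append_assoc append_Nil append_Nil2
          simp_thms imageI)
qed


section \<open>Modules over rings that need not be commutative\<close>

text \<open>The library's \<^locale>\<open>module\<close> requires a commutative ring of scalars.  The multiplicative
  fields of the module record carry no meaning here.\<close>

locale left_module = R?: ring R + M?: abelian_group M
  for R (structure) and M (structure) +
  assumes smult_closed [simp, intro]:
      "\<lbrakk>a \<in> carrier R; x \<in> carrier M\<rbrakk> \<Longrightarrow> a \<odot>\<^bsub>M\<^esub> x \<in> carrier M"
    and smult_l_distr:
      "\<lbrakk>a \<in> carrier R; b \<in> carrier R; x \<in> carrier M\<rbrakk> \<Longrightarrow>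
        (a \<oplus> b) \<odot>\<^bsub>M\<^esub> x = a \<odot>\<^bsub>M\<^esub> x \<oplus>\<^bsub>M\<^esub> b \<odot>\<^bsub>M\<^esub> x"
    and smult_r_distr:
      "\<lbrakk>a \<in> carrier R; x \<in> carrier M; y \<in> carrier M\<rbrakk> \<Longrightarrow>
        a \<odot>\<^bsub>M\<^esub> (x \<oplus>\<^bsub>M\<^esub> y) = a \<odot>\<^bsub>M\<^esub> x \<oplus>\<^bsub>M\<^esub> a \<odot>\<^bsub>M\<^esub> y"
    and smult_assoc1:
      "\<lbrakk>a \<in> carrier R; b \<in> carrier R; x \<in> carrier M\<rbrakk> \<Longrightarrow>
        (a \<otimes> b) \<odot>\<^bsub>M\<^esub> x = a \<odot>\<^bsub>M\<^esub> (b \<odot>\<^bsub>M\<^esub> x)"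
    and smult_one [simp]: "x \<in> carrier M \<Longrightarrow> \<one> \<odot>\<^bsub>M\<^esub> x = x"

definition lmod_hom ::
    "('r, 'k) ring_scheme \<Rightarrow> ('r, 'x, 'l) module_scheme \<Rightarrow> ('r, 'y, 'm) module_scheme \<Rightarrow> ('x \<Rightarrow> 'y) set"
  where "lmod_hom R M N =
    {f \<in> hom (add_monoid M) (add_monoid N).
       \<forall>r \<in> carrier R. \<forall>x \<in> carrier M. f (r \<odot>\<^bsub>M\<^esub> x) = r \<odot>\<^bsub>N\<^esub> f x}"

definition lmod_ker :: "('r, 'x, 'l) module_scheme \<Rightarrow> ('r, 'y, 'm) module_scheme \<Rightarrow> ('x \<Rightarrow> 'y) \<Rightarrow> 'x set"
  where "lmod_ker M N f = kernel (add_monoid M) (add_monoid N) f"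

definition fin_gen :: "('r, 'k) ring_scheme \<Rightarrow> ('r, 'x, 'l) module_scheme \<Rightarrow> bool"
  where "fin_gen R M \<longleftrightarrow>
    (\<exists>S. finite S \<and> S \<subseteq> carrier M \<and> (\<forall>H. submodule H R M \<and> S \<subseteq> H \<longrightarrow> H = carrier M))"

text \<open>Lifting property against epimorphisms.  A definition cannot quantify over the types of the
  test modules, so they are fixed; the choice is immaterial because the types are large enough for
  the free module on the elements of the module in question, see \<open>projective_module_lift\<close> below.\<close>

definition projective_module :: "('r, 'k) ring_scheme \<Rightarrow> ('r, 'p) module \<Rightarrow> bool"
  where "projective_module R P \<longleftrightarrow> left_module R P \<and>
    (\<forall>(N :: ('r, 'p \<Rightarrow> 'r) module) (L :: ('r, 'p) module) g f.
       left_module R N \<and> left_module R L \<and>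
       g \<in> lmod_hom R N L \<and> g ` carrier N = carrier L \<and> f \<in> lmod_hom R P L \<longrightarrow>
       (\<exists>h \<in> lmod_hom R P N. \<forall>x \<in> carrier P. g (h x) = f x))"

definition projective_resolution ::
    "('r, 'k) ring_scheme \<Rightarrow> ('r, 'x) module \<Rightarrow> (nat \<Rightarrow> ('r, 'p) module) \<Rightarrow>
      (nat \<Rightarrow> 'p \<Rightarrow> 'p) \<Rightarrow> ('p \<Rightarrow> 'x) \<Rightarrow> bool"
  where "projective_resolution R X P d e \<longleftrightarrow>
    left_module R X \<and>
    (\<forall>n. projective_module R (P n)) \<and>
    (\<forall>n. d n \<in> lmod_hom R (P (Suc n)) (P n)) \<and>
    e \<in> lmod_hom R (P 0) X \<and>
    e ` carrier (P 0) = carrier X \<and>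
    lmod_ker (P 0) X e = d 0 ` carrier (P 1) \<and>
    (\<forall>n. lmod_ker (P (Suc n)) (P n) (d n) = d (Suc n) ` carrier (P (Suc (Suc n))))"

text \<open>The carriers of the resolving modules have to live in a fixed type as well.  For an
  \<open>R\<close>-module \<open>X\<close> with carriers in the types \<open>'r\<close> and \<open>'x\<close>, each of the two conditions below is
  witnessed, if at all, by a resolution whose terms have cardinality at most
  \<open>max(\<aleph>\<^sub>0, |'r|, |'x|)\<close> (take successive free modules on elements of the kernels).  All these
  modules are isomorphic to modules with carrier in \<open>nat \<times> 'x \<Rightarrow> 'r\<close> (when \<open>'r\<close> has only one
  element all modules are zero), so no resolution is lost.\<close>

definition type_FP_infinity :: "('r, 'k) ring_scheme \<Rightarrow> ('r, 'x) module \<Rightarrow> bool"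
  where "type_FP_infinity R X \<longleftrightarrow>
    (\<exists>(P :: nat \<Rightarrow> ('r, nat \<times> 'x \<Rightarrow> 'r) module) d e.
       projective_resolution R X P d e \<and> (\<forall>n. fin_gen R (P n)))"

definition projective_dimension :: "('r, 'k) ring_scheme \<Rightarrow> ('r, 'x) module \<Rightarrow> enat"
  where "projective_dimension R X =
    Inf {enat n | n. \<exists>(P :: nat \<Rightarrow> ('r, nat \<times> 'x \<Rightarrow> 'r) module) d e.
       projective_resolution R X P d e \<and> (\<forall>k>n. carrier (P k) = {\<zero>\<^bsub>P k\<^esub>})}"

context left_module begin

lemma smult_zero_left [simp]: "x \<in> carrier M \<Longrightarrow> \<zero>\<^bsub>R\<^esub> \<odot>\<^bsub>M\<^esub> x = \<zero>\<^bsub>M\<^esub>"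
  using smult_l_distr[of "\<zero>\<^bsub>R\<^esub>" "\<zero>\<^bsub>R\<^esub>" x] M.add.l_cancel_one'[of "\<zero>\<^bsub>R\<^esub> \<odot>\<^bsub>M\<^esub> x"] by simp

lemma smult_zero_right [simp]: "a \<in> carrier R \<Longrightarrow> a \<odot>\<^bsub>M\<^esub> \<zero>\<^bsub>M\<^esub> = \<zero>\<^bsub>M\<^esub>"
  using smult_r_distr[of a "\<zero>\<^bsub>M\<^esub>" "\<zero>\<^bsub>M\<^esub>"] M.add.l_cancel_one'[of "a \<odot>\<^bsub>M\<^esub> \<zero>\<^bsub>M\<^esub>"] by simp

lemma smult_finsum:
  assumes "finite I" "a \<in> carrier R" "f \<in> I \<rightarrow> carrier M"
  shows "a \<odot>\<^bsub>M\<^esub> finsum M f I = finsum M (\<lambda>i. a \<odot>\<^bsub>M\<^esub> f i) I"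
  using assms
proof (induction I)
  case (insert i I)
  then show ?case
    by (simp add: smult_r_distr Pi_iff M.finsum_closed)
qed simp

end

lemma lmod_hom_finsum:
  assumes "left_module R M" "left_module R N" "h \<in> lmod_hom R M N"
    and "finite I" "f \<in> I \<rightarrow> carrier M"
  shows "h (finsum M f I) = finsum N (\<lambda>i. h (f i)) I"
proof -
  interpret M: left_module R M by fact
  interpret N: left_module R N by fact
  have h: "h \<in> carrier M \<rightarrow> carrier N" "\<And>x y. x \<in> carrier M \<Longrightarrow> y \<in> carrier M \<Longrightarrow> h (x \<oplus>\<^bsub>M\<^esub> y) = h x \<oplus>\<^bsub>N\<^esub> h y"
    using assms(3) by (auto simp: lmod_hom_def hom_def)
  have h0: "h \<zero>\<^bsub>M\<^esub> = \<zero>\<^bsub>N\<^esub>"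
    using h(2)[of "\<zero>\<^bsub>M\<^esub>" "\<zero>\<^bsub>M\<^esub>"] h(1) by (simp add: Pi_iff)
  show ?thesis
    using assms(4,5)
    by (induction I) (use h in \<open>auto simp: h0 Pi_iff M.finsum_closed\<close>)
qed

definition free_on :: "('r, 'k) ring_scheme \<Rightarrow> 'p set \<Rightarrow> ('r, 'p \<Rightarrow> 'r) module"
  where "free_on R B =
    \<lparr> carrier = {f. range f \<subseteq> carrier R \<and> finite {x. f x \<noteq> \<zero>\<^bsub>R\<^esub>} \<and> {x. f x \<noteq> \<zero>\<^bsub>R\<^esub>} \<subseteq> B},
      mult = undefined, one = undefined,
      zero = (\<lambda>_. \<zero>\<^bsub>R\<^esub>), add = (\<lambda>f g x. f x \<oplus>\<^bsub>R\<^esub> g x), smult = (\<lambda>r f x. r \<otimes>\<^bsub>R\<^esub> f x) \<rparr>"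

definition free_eval :: "('r, 'k) ring_scheme \<Rightarrow> ('r, 'x, 'l) module_scheme \<Rightarrow> ('p \<Rightarrow> 'x) \<Rightarrow> ('p \<Rightarrow> 'r) \<Rightarrow> 'x"
  where "free_eval R N b f = finsum N (\<lambda>x. f x \<odot>\<^bsub>N\<^esub> b x) {x. f x \<noteq> \<zero>\<^bsub>R\<^esub>}"

lemma left_module_free_on:
  assumes "ring R" shows "left_module R (free_on R B)"
proof -
  interpret ring R by fact
  have inC: "f x \<in> carrier R" if "f \<in> carrier (free_on R B)" for f and x
    using that by (auto simp: free_on_def)
  have add: "(\<lambda>x. f x \<oplus>\<^bsub>R\<^esub> g x) \<in> carrier (free_on R B)"
    if "f \<in> carrier (free_on R B)" "g \<in> carrier (free_on R B)" for f g
  proof -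
    have "{x. f x \<oplus>\<^bsub>R\<^esub> g x \<noteq> \<zero>\<^bsub>R\<^esub>} \<subseteq> {x. f x \<noteq> \<zero>\<^bsub>R\<^esub>} \<union> {x. g x \<noteq> \<zero>\<^bsub>R\<^esub>}"
      by auto
    then show ?thesis
      using that inC[OF that(1)] inC[OF that(2)]
      by (auto simp: free_on_def intro: finite_subset)
  qed
  have smult: "(\<lambda>x. r \<otimes>\<^bsub>R\<^esub> f x) \<in> carrier (free_on R B)"
    if "f \<in> carrier (free_on R B)" "r \<in> carrier R" for f r
  proof -
    have "{x. r \<otimes>\<^bsub>R\<^esub> f x \<noteq> \<zero>\<^bsub>R\<^esub>} \<subseteq> {x. f x \<noteq> \<zero>\<^bsub>R\<^esub>}"
      using that by auto
    then show ?thesis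
      using that inC[OF that(1)]
      by (auto simp: free_on_def intro: finite_subset)
  qed
  have neg: "(\<lambda>x. \<ominus>\<^bsub>R\<^esub> f x) \<in> carrier (free_on R B)"
    if "f \<in> carrier (free_on R B)" for f
  proof -
    have "{x. \<ominus>\<^bsub>R\<^esub> f x \<noteq> \<zero>\<^bsub>R\<^esub>} \<subseteq> {x. f x \<noteq> \<zero>\<^bsub>R\<^esub>}"
      by auto
    then show ?thesis
      using that inC[OF that(1)]
      by (auto simp: free_on_def intro: finite_subset)
  qed
  have zero: "(\<lambda>_. \<zero>\<^bsub>R\<^esub>) \<in> carrier (free_on R B)"
    by (simp add: free_on_def)
  have ops: "f \<oplus>\<^bsub>free_on R B\<^esub> g = (\<lambda>x. f x \<oplus>\<^bsub>R\<^esub> g x)" "r \<odot>\<^bsub>free_on R B\<^esub> f = (\<lambda>x. r \<otimes>\<^bsub>R\<^esub> f x)"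
    "\<zero>\<^bsub>free_on R B\<^esub> = (\<lambda>_. \<zero>\<^bsub>R\<^esub>)" for f g r
    by (simp_all add: free_on_def)
  have "abelian_group (free_on R B)"
  proof (rule abelian_groupI)
    fix f assume f: "f \<in> carrier (free_on R B)"
    then show "\<exists>g \<in> carrier (free_on R B). g \<oplus>\<^bsub>free_on R B\<^esub> f = \<zero>\<^bsub>free_on R B\<^esub>"
      using inC[OF f] by (intro bexI[OF _ neg[OF f]]) (simp add: ops l_neg)
  qed (auto simp: ops add zero inC a_ac)
  then show ?thesis
    unfolding left_module_def left_module_axioms_def
    by (auto simp: assms ops smult inC l_distr r_distr m_assoc)
qed

lemma free_eval_eq:
  assumes "left_module R N" "b \<in> B \<rightarrow> carrier N" "f \<in> carrier (free_on R B)"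
    and "finite I" "{x. f x \<noteq> \<zero>\<^bsub>R\<^esub>} \<subseteq> I" "I \<subseteq> B"
  shows "free_eval R N b f = finsum N (\<lambda>x. f x \<odot>\<^bsub>N\<^esub> b x) I"
proof -
  interpret left_module R N by fact
  have "f x \<in> carrier R" for x using assms(3) by (auto simp: free_on_def)
  with assms show ?thesis
    unfolding free_eval_def
    by (intro M.add.finprod_mono_neutral_cong_left) (auto simp: Pi_iff subset_iff)
qed

lemma free_eval_hom:
  assumes "left_module R N" "b \<in> B \<rightarrow> carrier N"
  shows "free_eval R N b \<in> lmod_hom R (free_on R B) N"
proof -
  interpret N: left_module R N by fact
  interpret F: left_module R "free_on R B" by (rule left_module_free_on) (rule N.R.ring_axioms)
  have C: "f x \<in> carrier R" "finite {x. f x \<noteq> \<zero>\<^bsub>R\<^esub>}" "{x. f x \<noteq> \<zero>\<^bsub>R\<^esub>} \<subseteq> B"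
    if "f \<in> carrier (free_on R B)" for f x
    using that by (auto simp: free_on_def)
  have b: "b x \<in> carrier N" if "x \<in> B" for x using assms(2) that by auto
  have ops: "f \<oplus>\<^bsub>free_on R B\<^esub> g = (\<lambda>x. f x \<oplus>\<^bsub>R\<^esub> g x)" "r \<odot>\<^bsub>free_on R B\<^esub> f = (\<lambda>x. r \<otimes>\<^bsub>R\<^esub> f x)" for f g r
    by (simp_all add: free_on_def)
  have closed: "free_eval R N b f \<in> carrier N" if "f \<in> carrier (free_on R B)" for f
    unfolding free_eval_def using C[OF that] b by (intro N.finsum_closed) auto
  have add: "free_eval R N b (f \<oplus>\<^bsub>free_on R B\<^esub> g) = free_eval R N b f \<oplus>\<^bsub>N\<^esub> free_eval R N b g"
    if f: "f \<in> carrier (free_on R B)" and g: "g \<in> carrier (free_on R B)" for f g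
  proof -
    let ?I = "{x. f x \<noteq> \<zero>\<^bsub>R\<^esub>} \<union> {x. g x \<noteq> \<zero>\<^bsub>R\<^esub>}"
    have I: "finite ?I" "?I \<subseteq> B" using C[OF f] C[OF g] by auto
    have "free_eval R N b (f \<oplus>\<^bsub>free_on R B\<^esub> g) = finsum N (\<lambda>x. (f \<oplus>\<^bsub>free_on R B\<^esub> g) x \<odot>\<^bsub>N\<^esub> b x) ?I"
      by (rule free_eval_eq[OF assms F.add.m_closed[OF f g, simplified] I(1) _ I(2)]) (auto simp: ops)
    also have "\<dots> = finsum N (\<lambda>x. f x \<odot>\<^bsub>N\<^esub> b x \<oplus>\<^bsub>N\<^esub> g x \<odot>\<^bsub>N\<^esub> b x) ?I"
      using C(1)[OF f] C(1)[OF g] I b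
      by (intro N.finsum_cong') (auto simp: ops N.smult_l_distr subset_iff)
    also have "\<dots> = finsum N (\<lambda>x. f x \<odot>\<^bsub>N\<^esub> b x) ?I \<oplus>\<^bsub>N\<^esub> finsum N (\<lambda>x. g x \<odot>\<^bsub>N\<^esub> b x) ?I"
      using C(1)[OF f] C(1)[OF g] I b
      by (intro N.finsum_addf) (auto simp: subset_iff)
    finally show ?thesis
      using free_eval_eq[OF assms f I(1) _ I(2)] free_eval_eq[OF assms g I(1) _ I(2)] by auto
  qed
  have smult: "free_eval R N b (r \<odot>\<^bsub>free_on R B\<^esub> f) = r \<odot>\<^bsub>N\<^esub> free_eval R N b f"
    if f: "f \<in> carrier (free_on R B)" and r: "r \<in> carrier R" for f r
  proof -
    let ?I = "{x. f x \<noteq> \<zero>\<^bsub>R\<^esub>}"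
    have "free_eval R N b (r \<odot>\<^bsub>free_on R B\<^esub> f) = finsum N (\<lambda>x. (r \<odot>\<^bsub>free_on R B\<^esub> f) x \<odot>\<^bsub>N\<^esub> b x) ?I"
      by (rule free_eval_eq[OF assms F.smult_closed[OF r f] C(2)[OF f] _ C(3)[OF f]]) (use r in \<open>auto simp: ops\<close>)
    also have "\<dots> = finsum N (\<lambda>x. r \<odot>\<^bsub>N\<^esub> (f x \<odot>\<^bsub>N\<^esub> b x)) ?I"
      using C[OF f] b r
      by (intro N.finsum_cong') (auto simp: ops N.smult_assoc1 subset_iff)
    also have "\<dots> = r \<odot>\<^bsub>N\<^esub> finsum N (\<lambda>x. f x \<odot>\<^bsub>N\<^esub> b x) ?I"
      using C[OF f] b r
      by (intro N.smult_finsum[symmetric]) (auto simp: subset_iff)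
    finally show ?thesis by (simp add: free_eval_def)
  qed
  show ?thesis
    unfolding lmod_hom_def hom_def using closed add smult by auto
qed

lemma projective_module_lift:
  assumes P: "projective_module R P"
    and N: "left_module R N" and L: "left_module R L"
    and g: "g \<in> lmod_hom R N L" "g ` carrier N = carrier L" and f: "f \<in> lmod_hom R P L"
  shows "\<exists>h \<in> lmod_hom R P N. \<forall>x \<in> carrier P. g (h x) = f x"
proof -
  have PM: "left_module R P" using P by (simp add: projective_module_def)
  interpret P: left_module R P by fact
  interpret N: left_module R N by fact
  interpret L: left_module R L by fact
  define F where "F = free_on R (carrier P)"
  have FM: "left_module R F"
    unfolding F_def by (rule left_module_free_on) (rule P.R.ring_axioms)
  define p where "p = free_eval R P (\<lambda>x. x)"
  have p: "p \<in> lmod_hom R F P"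
    unfolding F_def p_def by (rule free_eval_hom[OF PM]) auto
  have "x \<in> p ` carrier F" if x: "x \<in> carrier P" for x
  proof -
    let ?d = "\<lambda>y. if y = x then \<one>\<^bsub>R\<^esub> else \<zero>\<^bsub>R\<^esub>"
    have d: "?d \<in> carrier F" using x by (auto simp: F_def free_on_def)
    have "p ?d = finsum P (\<lambda>y. ?d y \<odot>\<^bsub>P\<^esub> y) {x}"
      unfolding p_def using x
      by (intro free_eval_eq[OF PM, where B = "carrier P"] d[unfolded F_def]) auto
    also have "\<dots> = x" using x by simp
    finally show ?thesis using d by (metis image_eqI)
  qed
  moreover have "p \<in> carrier F \<rightarrow> carrier P" using p by (auto simp: lmod_hom_def hom_def)
  ultimately have p_onto: "p ` carrier F = carrier P" by auto
  have "(\<lambda>x. x) \<in> lmod_hom R P P" by (auto simp: lmod_hom_def hom_def)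
  with P FM PM p p_onto obtain s where s: "s \<in> lmod_hom R P F" "\<And>x. x \<in> carrier P \<Longrightarrow> p (s x) = x"
    unfolding projective_module_def by metis
  have fC: "f x \<in> carrier L" if "x \<in> carrier P" for x
    using f that by (auto simp: lmod_hom_def hom_def)
  have "\<forall>x \<in> carrier P. \<exists>y \<in> carrier N. g y = f x"
    using fC g(2) by (metis imageE)
  then obtain b where b: "\<And>x. x \<in> carrier P \<Longrightarrow> b x \<in> carrier N" "\<And>x. x \<in> carrier P \<Longrightarrow> g (b x) = f x"
    by metis
  define q where "q = free_eval R N b"
  have q: "q \<in> lmod_hom R F N"
    unfolding q_def F_def by (rule free_eval_hom[OF N]) (use b in auto)
  have gq: "g (q t) = f (p t)" if t: "t \<in> carrier F" for t
  proof -
    let ?I = "{x. t x \<noteq> \<zero>\<^bsub>R\<^esub>}"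
    have I: "finite ?I" "?I \<subseteq> carrier P" "\<And>x. t x \<in> carrier R"
      using t by (auto simp: F_def free_on_def)
    have "g (q t) = finsum L (\<lambda>x. g (t x \<odot>\<^bsub>N\<^esub> b x)) ?I"
      unfolding q_def free_eval_def
      by (rule lmod_hom_finsum[OF N L g(1) I(1)]) (use I b in auto)
    also have "\<dots> = finsum L (\<lambda>x. f (t x \<odot>\<^bsub>P\<^esub> x)) ?I"
    proof (rule L.finsum_cong')
      show "g (t x \<odot>\<^bsub>N\<^esub> b x) = f (t x \<odot>\<^bsub>P\<^esub> x)" if "x \<in> ?I" for x
        using that I b[of x] g(1) f unfolding lmod_hom_def by auto
    qed (use I fC in auto)
    also have "\<dots> = f (p t)"
      unfolding p_def free_eval_def
      by (rule lmod_hom_finsum[OF PM L f I(1), symmetric]) (use I in auto)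
    finally show ?thesis .
  qed
  have sC: "s x \<in> carrier F" if "x \<in> carrier P" for x
    using s(1) that by (auto simp: lmod_hom_def hom_def)
  have "(\<lambda>x. q (s x)) \<in> lmod_hom R P N"
    using s(1) q unfolding lmod_hom_def hom_def by (auto simp: Pi_iff)
  then show ?thesis
    using gq sC s(2) by (intro bexI) auto
qed


section \<open>The integral monoid ring and its bimodule structure\<close>

text \<open>\<^typ>\<open>'m \<Rightarrow>\<^sub>0 int\<close> is the type of finitely supported integer functions, and
  \<^term>\<open>frag_extend\<close> is linear extension, so the following is the biadditive extension of \<open>c\<close>.\<close>

definition biext :: "('x \<Rightarrow> 'y \<Rightarrow> 'z) \<Rightarrow> ('x \<Rightarrow>\<^sub>0 int) \<Rightarrow> ('y \<Rightarrow>\<^sub>0 int) \<Rightarrow> ('z \<Rightarrow>\<^sub>0 int)"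
  where "biext c f g = frag_extend (\<lambda>x. frag_extend (\<lambda>y. frag_of (c x y)) g) f"

definition monoid_ring :: "('m, 'k) monoid_scheme \<Rightarrow> ('m \<Rightarrow>\<^sub>0 int) ring"
  where "monoid_ring M =
    \<lparr> carrier = {f. Poly_Mapping.keys f \<subseteq> carrier M},
      mult = biext (\<lambda>x y. x \<otimes>\<^bsub>M\<^esub> y), one = frag_of \<one>\<^bsub>M\<^esub>, zero = 0, add = (+) \<rparr>"

definition opposite_monoid :: "('m, 'k) monoid_scheme \<Rightarrow> ('m, 'k) monoid_scheme"
  where "opposite_monoid M = M\<lparr>mult := (\<lambda>x y. y \<otimes>\<^bsub>M\<^esub> x)\<rparr>"

definition bimonoid_ring :: "('m, 'k) monoid_scheme \<Rightarrow> ('m \<times> 'm \<Rightarrow>\<^sub>0 int) ring"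
  where "bimonoid_ring M = monoid_ring (M \<times>\<times> opposite_monoid M)"

definition bimodule_ZM :: "('m, 'k) monoid_scheme \<Rightarrow> ('m \<times> 'm \<Rightarrow>\<^sub>0 int, 'm \<Rightarrow>\<^sub>0 int) module"
  where "bimodule_ZM M =
    \<lparr> carrier = carrier (monoid_ring M), mult = undefined, one = undefined,
      zero = 0, add = (+),
      smult = biext (\<lambda>(m, n) x. m \<otimes>\<^bsub>M\<^esub> x \<otimes>\<^bsub>M\<^esub> n) \<rparr>"

definition type_bi_FP_infinity :: "('m, 'k) monoid_scheme \<Rightarrow> bool"
  where "type_bi_FP_infinity M \<longleftrightarrow> type_FP_infinity (bimonoid_ring M) (bimodule_ZM M)"

definition hochschild_dimension :: "('m, 'k) monoid_scheme \<Rightarrow> enat"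
  where "hochschild_dimension M = projective_dimension (bimonoid_ring M) (bimodule_ZM M)"

lemma biext_of [simp]: "biext c (frag_of x) (frag_of y) = frag_of (c x y)"
  by (simp add: biext_def)

lemma biext_zero [simp]: "biext c 0 g = 0" "biext c f 0 = 0"
  by (simp_all add: biext_def frag_extend_eq_0)

lemma biext_add_left: "biext c (f + f') g = biext c f g + biext c f' g"
  by (simp add: biext_def frag_extend_add)

lemma biext_diff_left: "biext c (f - f') g = biext c f g - biext c f' g"
  by (simp add: biext_def frag_extend_diff)

lemma biext_add_right: "biext c f (g + g') = biext c f g + biext c f g'"
  by (simp add: biext_def frag_extend_add frag_extend_def[of _ f] frag_cmul_distrib2 sum.distrib)

lemma biext_diff_right: "biext c f (g - g') = biext c f g - biext c f g'"
  by (metis biext_add_right add_diff_cancel diff_add_cancel)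

lemma keys_biext:
  assumes "Poly_Mapping.keys f \<subseteq> S" "Poly_Mapping.keys g \<subseteq> T"
    and "\<And>x y. x \<in> S \<Longrightarrow> y \<in> T \<Longrightarrow> c x y \<in> U"
  shows "Poly_Mapping.keys (biext c f g) \<subseteq> U"
proof -
  have "Poly_Mapping.keys (frag_extend (\<lambda>y. frag_of (c x y)) g) \<subseteq> U" if "x \<in> S" for x
    using keys_frag_extend[of "\<lambda>y. frag_of (c x y)" g] assms(2) assms(3)[OF that] by fastforce
  then show ?thesis
    unfolding biext_def
    using keys_frag_extend[of "\<lambda>x. frag_extend (\<lambda>y. frag_of (c x y)) g" f] assms(1) by fastforce
qed

lemma biext_assoc:
  assumes f: "Poly_Mapping.keys f \<subseteq> S" and g: "Poly_Mapping.keys g \<subseteq> T"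
    and h: "Poly_Mapping.keys h \<subseteq> U"
    and c: "\<And>x y z. x \<in> S \<Longrightarrow> y \<in> T \<Longrightarrow> z \<in> U \<Longrightarrow> c1 (c2 x y) z = c3 x (c4 y z)"
  shows "biext c1 (biext c2 f g) h = biext c3 f (biext c4 g h)"
  using f
proof (induction f rule: frag_induction)
  case (one x)
  show ?case using g
  proof (induction g rule: frag_induction)
    case (one y)
    show ?case using h
      by (induction h rule: frag_induction) (simp_all add: c \<open>x \<in> S\<close> \<open>y \<in> T\<close> biext_diff_right)
  qed (simp_all add: biext_diff_left biext_diff_right)
qed (simp_all add: biext_diff_left)

lemma biext_neutral_left:
  assumes "Poly_Mapping.keys f \<subseteq> S" "\<And>x. x \<in> S \<Longrightarrow> c a x = x"
  shows "biext c (frag_of a) f = f"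
  using assms(1) by (induction f rule: frag_induction) (simp_all add: biext_diff_right assms(2))

lemma biext_neutral_right:
  assumes "Poly_Mapping.keys f \<subseteq> S" "\<And>x. x \<in> S \<Longrightarrow> c x a = x"
  shows "biext c f (frag_of a) = f"
  using assms(1) by (induction f rule: frag_induction) (simp_all add: biext_diff_left assms(2))

lemma ring_monoid_ring:
  assumes "monoid M" shows "ring (monoid_ring M)"
proof -
  interpret monoid M by fact
  have "abelian_group (monoid_ring M)"
  proof (rule abelian_groupI)
    fix f assume "f \<in> carrier (monoid_ring M)"
    then show "\<exists>g \<in> carrier (monoid_ring M). g \<oplus>\<^bsub>monoid_ring M\<^esub> f = \<zero>\<^bsub>monoid_ring M\<^esub>"
      by (intro bexI[of _ "- f"]) (auto simp: monoid_ring_def)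
  next
    fix f g assume "f \<in> carrier (monoid_ring M)" "g \<in> carrier (monoid_ring M)"
    then show "f \<oplus>\<^bsub>monoid_ring M\<^esub> g \<in> carrier (monoid_ring M)"
      using keys_add[of f g] by (auto simp: monoid_ring_def)
  qed (auto simp: monoid_ring_def algebra_simps)
  moreover have "monoid (monoid_ring M)"
  proof (rule monoidI)
    show "f \<otimes>\<^bsub>monoid_ring M\<^esub> g \<in> carrier (monoid_ring M)"
      if "f \<in> carrier (monoid_ring M)" "g \<in> carrier (monoid_ring M)" for f g
      using that by (simp add: monoid_ring_def) (rule keys_biext, auto)
    show "f \<otimes>\<^bsub>monoid_ring M\<^esub> g \<otimes>\<^bsub>monoid_ring M\<^esub> h = f \<otimes>\<^bsub>monoid_ring M\<^esub> (g \<otimes>\<^bsub>monoid_ring M\<^esub> h)"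
      if "f \<in> carrier (monoid_ring M)" "g \<in> carrier (monoid_ring M)" "h \<in> carrier (monoid_ring M)" for f g h
      using that by (simp add: monoid_ring_def) (rule biext_assoc, auto simp: m_assoc)
  qed (auto simp: monoid_ring_def intro!: biext_neutral_left biext_neutral_right)
  ultimately show ?thesis
    by (intro ringI) (auto simp: monoid_ring_def biext_add_left biext_add_right
        dest: abelian_group.axioms monoid.m_assoc)
qed

lemma monoid_opposite_monoid:
  assumes "monoid M" shows "monoid (opposite_monoid M)"
proof -
  interpret monoid M by fact
  show ?thesis by (rule monoidI) (auto simp: opposite_monoid_def m_assoc)
qed

lemma left_module_bimodule_ZM:
  assumes "monoid M" shows "left_module (bimonoid_ring M) (bimodule_ZM M)"
proof -
  interpret monoid M by fact
  interpret Z: ring "monoid_ring M" by (rule ring_monoid_ring[OF assms])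
  have R: "ring (bimonoid_ring M)"
    unfolding bimonoid_ring_def
    by (intro ring_monoid_ring DirProd_monoid monoid_opposite_monoid assms)
  have "abelian_group (bimodule_ZM M)"
  proof (rule abelian_groupI)
    fix f assume "f \<in> carrier (bimodule_ZM M)"
    then show "\<exists>g \<in> carrier (bimodule_ZM M). g \<oplus>\<^bsub>bimodule_ZM M\<^esub> f = \<zero>\<^bsub>bimodule_ZM M\<^esub>"
      by (intro bexI[of _ "- f"]) (auto simp: bimodule_ZM_def monoid_ring_def)
  next
    fix f g assume "f \<in> carrier (bimodule_ZM M)" "g \<in> carrier (bimodule_ZM M)"
    then show "f \<oplus>\<^bsub>bimodule_ZM M\<^esub> g \<in> carrier (bimodule_ZM M)"
      using keys_add[of f g] by (auto simp: bimodule_ZM_def monoid_ring_def)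
  qed (auto simp: bimodule_ZM_def monoid_ring_def algebra_simps)
  moreover have "left_module_axioms (bimonoid_ring M) (bimodule_ZM M)"
  proof -
    have car: "carrier (bimonoid_ring M) = {a. Poly_Mapping.keys a \<subseteq> carrier M \<times> carrier M}"
      "carrier (bimodule_ZM M) = {x. Poly_Mapping.keys x \<subseteq> carrier M}"
      by (simp_all add: bimonoid_ring_def bimodule_ZM_def monoid_ring_def opposite_monoid_def)
    have 1: "a \<odot>\<^bsub>bimodule_ZM M\<^esub> x \<in> carrier (bimodule_ZM M)"
      if "a \<in> carrier (bimonoid_ring M)" "x \<in> carrier (bimodule_ZM M)" for a x
      using that unfolding car by (simp add: bimodule_ZM_def) (rule keys_biext, auto)
    have 2: "(a \<otimes>\<^bsub>bimonoid_ring M\<^esub> b) \<odot>\<^bsub>bimodule_ZM M\<^esub> x = a \<odot>\<^bsub>bimodule_ZM M\<^esub> (b \<odot>\<^bsub>bimodule_ZM M\<^esub> x)"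
      if "a \<in> carrier (bimonoid_ring M)" "b \<in> carrier (bimonoid_ring M)" "x \<in> carrier (bimodule_ZM M)" for a b x
      using that unfolding car
      by (simp add: bimodule_ZM_def bimonoid_ring_def monoid_ring_def)
        (rule biext_assoc, auto simp: opposite_monoid_def m_assoc)
    have 3: "\<one>\<^bsub>bimonoid_ring M\<^esub> \<odot>\<^bsub>bimodule_ZM M\<^esub> x = x" if "x \<in> carrier (bimodule_ZM M)" for x
      using that unfolding car
      by (simp add: bimodule_ZM_def bimonoid_ring_def monoid_ring_def opposite_monoid_def)
        (rule biext_neutral_left, auto)
    show ?thesis
      using 1 2 3 unfolding left_module_axioms_def
      by (simp add: bimodule_ZM_def bimonoid_ring_def monoid_ring_def biext_add_left biext_add_right)
  qed
  ultimately show ?thesis using R by (simp add: left_module_def)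
qed

end

theory Submission
  imports Defs
begin

text \<open>
  The presentation resolution \<open>0 \<rightarrow> ZM \<otimes> ZM \<rightarrow> (ZM \<otimes> ZM)\<^sup>A \<rightarrow> ZM \<otimes> ZM \<rightarrow> ZM\<close> is exact as soon as the
  presentation is aspherical, here in the sense that the signed sum of \<open>[x] \<otimes> [y]\<close> over the steps
  \<open>x u y \<leftrightarrow> x v y\<close> of any closed derivation vanishes: summing along derivations to chosen
  normal forms then gives a contracting homotopy.

  For asphericity write \<open>u = p b \<dots>\<close>, \<open>v = p b' \<dots>\<close> with \<open>b \<noteq> b'\<close>, and reverse all words if necessary
  so that the longest common prefix \<open>p\<close> is no longer than the longest common suffix.
  Incompressibility says that no nonempty prefix of \<open>p\<close> is a suffix of \<open>u\<close> or \<open>v\<close>.  A step away from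
  the left end keeps the first \<open>|p| + 1\<close> letters, so steps at the left end alternate between \<open>u \<rightarrow> v\<close>
  and \<open>v \<rightarrow> u\<close>.  Between two of them a derivation from \<open>v z\<close> to \<open>v z'\<close> takes place, which inductively may
  be replaced by a derivation from \<open>z\<close> to \<open>z'\<close>; the two steps then cancel.  This left cancellation
  property and asphericity follow by induction on the length of the derivation.
\<close>

section \<open>Derivations\<close>

type_synonym 'a step = "'a list \<times> bool \<times> 'a list"

text \<open>A step \<open>(x, True, y)\<close> replaces \<open>x u y\<close> by \<open>x v y\<close>, and \<open>(x, False, y)\<close> does the converse.\<close>

definition relator :: "'a list \<Rightarrow> 'a list \<Rightarrow> bool \<Rightarrow> 'a list" where
  "relator u v \<beta> = (if \<beta> then u else v)"

fun path :: "'a list \<Rightarrow> 'a list \<Rightarrow> 'a list \<Rightarrow> 'a step list \<Rightarrow> 'a list \<Rightarrow> bool" where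
  "path u v w [] w' \<longleftrightarrow> w = w'"
| "path u v w ((x, \<beta>, y) # ss) w' \<longleftrightarrow>
    w = x @ relator u v \<beta> @ y \<and> path u v (x @ relator u v (\<not> \<beta>) @ y) ss w'"

fun path_sum :: "('a list \<Rightarrow> 'a list \<Rightarrow> 'g::ab_group_add) \<Rightarrow> 'a step list \<Rightarrow> 'g" where
  "path_sum c [] = 0"
| "path_sum c ((x, \<beta>, y) # ss) = (if \<beta> then c x y else - c x y) + path_sum c ss"

text \<open>Such a \<open>c\<close> sees the two contexts of a step only modulo the relation. The
  intended value is the basis element x \<otimes> y of the bimonoid ring; invariance makes opposite
  steps with congruent contexts cancel.\<close>

definition invariant_weight :: "'a list \<Rightarrow> 'a list \<Rightarrow> ('a list \<Rightarrow> 'a list \<Rightarrow> 'g) \<Rightarrow> bool" where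
  "invariant_weight u v c \<longleftrightarrow>
    (\<forall>x x' y. c (x @ u @ x') y = c (x @ v @ x') y \<and> c y (x @ u @ x') = c y (x @ v @ x'))"

lemma path_append:
  "path u v w (ss @ ts) w' \<longleftrightarrow> (\<exists>m. path u v w ss m \<and> path u v m ts w')"
  by (induction ss arbitrary: w) auto

lemma path_sum_append [simp]: "path_sum c (ss @ ts) = path_sum c ss + path_sum c ts"
  by (induction c ss rule: path_sum.induct) (auto simp: algebra_simps)

section \<open>Translation, reversal and inversion of derivations\<close>

definition step_extend :: "'a list \<Rightarrow> 'a list \<Rightarrow> 'a step \<Rightarrow> 'a step" where
  "step_extend a b = (\<lambda>(x, \<beta>, y). (a @ x, \<beta>, y @ b))"

lemma path_extend:
  "path u v w ss w' \<Longrightarrow> path u v (a @ w @ b) (map (step_extend a b) ss) (a @ w' @ b)"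
  by (induction u v w ss w' rule: path.induct) (auto simp: step_extend_def)

lemma path_sum_extend:
  "path_sum c (map (step_extend a b) ss) = path_sum (\<lambda>x y. c (a @ x) (y @ b)) ss"
  by (induction "\<lambda>x y. c (a @ x) (y @ b)" ss rule: path_sum.induct) (auto simp: step_extend_def)

definition step_rev :: "'a step \<Rightarrow> 'a step" where
  "step_rev = (\<lambda>(x, \<beta>, y). (rev y, \<beta>, rev x))"

lemma path_rev:
  "path u v w ss w' \<Longrightarrow> path (rev u) (rev v) (rev w) (map step_rev ss) (rev w')"
  by (induction u v w ss w' rule: path.induct) (auto simp: step_rev_def relator_def)

lemma path_sum_rev: "path_sum c (map step_rev ss) = path_sum (\<lambda>x y. c (rev y) (rev x)) ss"
  by (induction "\<lambda>x y. c (rev y) (rev x)" ss rule: path_sum.induct) (auto simp: step_rev_def)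

definition step_inverse :: "'a step \<Rightarrow> 'a step" where
  "step_inverse = (\<lambda>(x, \<beta>, y). (x, \<not> \<beta>, y))"

lemma path_inverse:
  "path u v w ss w' \<Longrightarrow> path u v w' (rev (map step_inverse ss)) w"
  by (induction u v w ss w' rule: path.induct)
    (auto simp: step_inverse_def path_append)

lemma path_sum_inverse: "path_sum c (rev (map step_inverse ss)) = - path_sum c ss"
  by (induction c ss rule: path_sum.induct) (auto simp: step_inverse_def)

section \<open>Weights that depend only on congruence classes\<close>

lemma invariant_weight_relator:
  assumes "invariant_weight u v c"
  shows "c (x @ relator u v \<beta> @ x') y = c (x @ relator u v \<gamma> @ x') y"
    "c y (x @ relator u v \<beta> @ x') = c y (x @ relator u v \<gamma> @ x')"
  using assms by (auto simp: invariant_weight_def relator_def)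

lemma invariant_weight_path:
  assumes "invariant_weight u v c" "path u v w ss w'"
  shows "c w y = c w' y" "c y w = c y w'"
proof -
  have "c w y = c w' y \<and> c y w = c y w'"
    using assms(2)
  proof (induction ss arbitrary: w)
    case (Cons s ss)
    then show ?case
      using invariant_weight_relator[OF assms(1)] by (cases s) (metis path.simps(2))
  qed simp
  then show "c w y = c w' y" "c y w = c y w'" by auto
qed

lemma invariant_weight_shift:
  assumes "invariant_weight u v c" shows "invariant_weight u v (\<lambda>x. c (s @ x))"
  using assms unfolding invariant_weight_def by (metis append.assoc)

lemma invariant_weight_rev:
  assumes "invariant_weight u v c"
  shows "invariant_weight (rev u) (rev v) (\<lambda>x y. c (rev y) (rev x))"
  using assms unfolding invariant_weight_def by simp

text \<open>A step with nonempty left context cannot touch the first letter, so that letter can be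
  deleted throughout; the weight has to put it back.\<close>

lemma path_tl:
  assumes "path u v (a # w) ss w'" "\<forall>s \<in> set ss. fst s \<noteq> []"
  shows "\<exists>w1. w' = a # w1 \<and> path u v w (map (\<lambda>(x, \<beta>, y). (tl x, \<beta>, y)) ss) w1
    \<and> path_sum c ss = path_sum (\<lambda>x. c (a # x)) (map (\<lambda>(x, \<beta>, y). (tl x, \<beta>, y)) ss)"
  using assms
proof (induction ss arbitrary: w)
  case (Cons s ss)
  obtain x \<beta> y where s: "s = (x, \<beta>, y)" by (cases s)
  with Cons.prems obtain x' where x: "x = a # x'" "w = x' @ relator u v \<beta> @ y"
    by (cases x) auto
  show ?case
    using Cons.IH[of "x' @ relator u v (\<not> \<beta>) @ y"] Cons.prems x s by (auto split: if_splits)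
qed auto

section \<open>Asphericity\<close>

locale separated_relation =
  fixes u v p :: "'a list" and b b' :: 'a and u' v' :: "'a list"
  assumes u: "u = p @ b # u'" and v: "v = p @ b' # v'" and b: "b \<noteq> b'"
    and end_u: "\<And>r. r \<noteq> [] \<Longrightarrow> prefix r p \<Longrightarrow> \<not> suffix r u"
    and end_v: "\<And>r. r \<noteq> [] \<Longrightarrow> prefix r p \<Longrightarrow> \<not> suffix r v"
begin

text \<open>Every relator starts with \<open>p\<close>, so in \<open>s z\<close> with \<open>free_end s\<close> no relator can start inside \<open>s\<close> unless
  its prefix \<open>p\<close> together with the next letter lies within \<open>s\<close>.\<close>

definition free_end :: "'a list \<Rightarrow> bool" where
  "free_end s \<longleftrightarrow> (\<forall>r. r \<noteq> [] \<longrightarrow> prefix r p \<longrightarrow> \<not> suffix r s)"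

lemma free_end_ConsD: "free_end (a # s) \<Longrightarrow> free_end s"
  unfolding free_end_def by (meson suffix_ConsI)

text \<open>If \<open>s\<close> were no longer than \<open>p\<close>, it would itself be a nonempty
  prefix of \<open>p\<close> and a suffix of \<open>s\<close>.\<close>

lemma free_end_length:
  assumes "free_end s" "s \<noteq> []" "prefix p (s @ z)"
  shows "length p < length s"
proof (rule ccontr)
  assume "\<not> length p < length s"
  then have "prefix s p" using assms(3) by (metis not_less prefix_length_prefix prefixI)
  then show False using assms(1,2) unfolding free_end_def by blast
qed

lemma relator_split: "\<exists>t. relator u v \<beta> = p @ (if \<beta> then b else b') # t"
  by (simp add: relator_def u v)

lemma head_relator:
  "take (Suc (length p)) (relator u v \<beta> @ y) = p @ [if \<beta> then b else b']"
  using relator_split[of \<beta>] by auto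

text \<open>Both relators begin with \<open>p\<close>, so a step with nonempty left context can
  first make a difference only after that context and \<open>p\<close>.\<close>

lemma path_head:
  assumes "path u v w ss w'" "\<forall>s \<in> set ss. fst s \<noteq> []"
  shows "take (Suc (length p)) w = take (Suc (length p)) w'"
  using assms
proof (induction ss arbitrary: w)
  case (Cons s ss)
  obtain x \<beta> y where s: "s = (x, \<beta>, y)" by (cases s)
  with Cons.prems obtain a x' where x: "x = a # x'" by (cases x) auto
  \<comment> \<open>One letter of \<open>x\<close> together with \<open>p\<close> already fills the
    window of \<open>length p + 1\<close> letters.\<close>
  have t: "take (Suc (length p)) (x @ p @ t) = take (Suc (length p)) (x @ p)" for t
    by (simp add: x)
  have "take (Suc (length p)) (x @ relator u v \<beta> @ y)
      = take (Suc (length p)) (x @ relator u v (\<not> \<beta>) @ y)"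
    using relator_split[of \<beta>] relator_split[of "\<not> \<beta>"] t by (metis append.assoc)
  with Cons.IH[of "x @ relator u v (\<not> \<beta>) @ y"] Cons.prems s show ?case by auto
qed simp

text \<open>Between two consecutive steps at the left end the derivation leaves the relator written by
  the first one untouched up to equivalence, so the two steps cancel.\<close>

lemma path_shorten:
  assumes IH: "\<And>ts s z z'. length ts < length ss \<Longrightarrow> free_end s \<Longrightarrow> path u v (s @ z) ts (s @ z') \<Longrightarrow>
      \<exists>rs. length rs \<le> length ts \<and> path u v z rs z' \<and>
        (\<forall>c :: 'a list \<Rightarrow> 'a list \<Rightarrow> 'g::ab_group_add. invariant_weight u v c \<longrightarrow>
           path_sum c ts = path_sum (\<lambda>x. c (s @ x)) rs)"
    and path: "path u v w ss w'"
    and head: "take (Suc (length p)) w = take (Suc (length p)) w'"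
    and ex: "\<not> (\<forall>s \<in> set ss. fst s \<noteq> [])"
  shows "\<exists>ts. length ts < length ss \<and> path u v w ts w' \<and>
    (\<forall>c :: 'a list \<Rightarrow> 'a list \<Rightarrow> 'g. invariant_weight u v c \<longrightarrow> path_sum c ts = path_sum c ss)"
proof -
  let ?P = "\<lambda>s. fst s = ([] :: 'a list)"
  have "\<exists>s \<in> set ss. ?P s" using ex by auto
  from split_list_first_prop[OF this]
  obtain s1 s ss' where ss: "ss = s1 @ s # ss'" and s: "?P s" and s1: "\<forall>s \<in> set s1. \<not> ?P s"
    by blast
  obtain \<beta> y where s: "s = ([], \<beta>, y)" using s by (cases s) auto
  have p1: "path u v w s1 (relator u v \<beta> @ y)" and p2: "path u v (relator u v (\<not> \<beta>) @ y) ss' w'"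
    using path by (auto simp: ss s path_append split: if_splits)
  have hw: "take (Suc (length p)) w = p @ [if \<beta> then b else b']"
    using path_head[OF p1] s1 head_relator[of \<beta> y] by auto
  \<comment> \<open>Without another step at the left end, \<open>w'\<close> would keep the letter
    that the first one wrote behind \<open>p\<close>, whereas \<open>w\<close> has the other letter
    there.\<close>
  have "\<exists>s \<in> set ss'. ?P s"
  proof (rule ccontr)
    assume "\<not> ?thesis"
    then have "take (Suc (length p)) w' = p @ [if \<not> \<beta> then b else b']"
      using path_head[OF p2] head_relator[of "\<not> \<beta>" y] by auto
    with hw head b show False by (auto split: if_splits)
  qed
  from split_list_first_prop[OF this]
  obtain s2 t s3 where ss': "ss' = s2 @ t # s3" and t: "?P t" and s2: "\<forall>s \<in> set s2. \<not> ?P s"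
    by blast
  obtain \<gamma> y' where t: "t = ([], \<gamma>, y')" using t by (cases t) auto
  have p3: "path u v (relator u v (\<not> \<beta>) @ y) s2 (relator u v \<gamma> @ y')" and p4: "path u v (relator u v (\<not> \<gamma>) @ y') s3 w'"
    using p2 by (auto simp: ss' t path_append split: if_splits)
  \<comment> \<open>The steps of \<open>s2\<close> keep the first \<open>length p + 1\<close>
    letters, so the second step at the left end must read the relator that the first one
    wrote.\<close>
  have "p @ [if \<not> \<beta> then b else b'] = p @ [if \<gamma> then b else b']"
    using path_head[OF p3] s2 head_relator[of "\<not> \<beta>" y] head_relator[of \<gamma> y'] by auto
  then have \<gamma>: "\<gamma> = (\<not> \<beta>)" using b by (auto split: if_splits)
  have "free_end (relator u v (\<not> \<beta>))" using end_u end_v by (auto simp: free_end_def relator_def)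
  \<comment> \<open>Both ends of \<open>s2\<close> begin with this relator; cancelling it leaves a
    derivation from \<open>y\<close> to \<open>y'\<close>.\<close>
  with IH[of s2 "relator u v (\<not> \<beta>)" y y'] p3
  obtain rs where rs: "length rs \<le> length s2" "path u v y rs y'"
    and sum: "\<And>c :: 'a list \<Rightarrow> 'a list \<Rightarrow> 'g. invariant_weight u v c \<Longrightarrow>
       path_sum c s2 = path_sum (\<lambda>x. c (relator u v (\<not> \<beta>) @ x)) rs"
    unfolding \<gamma> by (auto simp: ss ss')
  \<comment> \<open>The derivation from \<open>y\<close> to \<open>y'\<close> is run behind the
    original relator instead, which saves the two steps at the left end.\<close>
  let ?ts = "s1 @ map (step_extend (relator u v \<beta>) []) rs @ s3"
  have "path u v w ?ts w'"
    using p1 path_extend[OF rs(2), of "relator u v \<beta>" "[]"] p4 unfolding path_append \<gamma> by auto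
  moreover have "length ?ts < length ss" using rs(1) by (simp add: ss ss')
  moreover have "path_sum c ?ts = path_sum c ss"
    if c: "invariant_weight u v c" for c :: "'a list \<Rightarrow> 'a list \<Rightarrow> 'g"
  proof -
    have "c (relator u v (\<not> \<beta>) @ x) = c (relator u v \<beta> @ x)" for x
      using invariant_weight_relator(1)[OF c, of "[]" "\<not> \<beta>" x _ \<beta>] by auto
    \<comment> \<open>The two deleted steps have opposite signs, and their weights agree because
      \<open>y\<close> and \<open>y'\<close> are congruent.\<close>
    moreover have "c [] y = c [] y'" using invariant_weight_path[OF c rs(2)] by blast
    ultimately show ?thesis
      by (simp add: ss ss' s t \<gamma> sum[OF c] path_sum_extend)
  qed
  ultimately show ?thesis by blast
qed

text \<open>Outer induction on the number of steps, inner induction on \<open>s\<close>. Without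
  steps at the left end the first letter of \<open>s\<close> is stripped; otherwise
  \<open>path_shorten\<close> applies. One \<open>rs\<close> has to serve all weights, since
  stripping a letter changes the weight.\<close>

lemma path_cancel:
  assumes "free_end s" "path u v (s @ z) ss (s @ z')"
  shows "\<exists>rs. length rs \<le> length ss \<and> path u v z rs z' \<and>
    (\<forall>c :: 'a list \<Rightarrow> 'a list \<Rightarrow> 'g::ab_group_add. invariant_weight u v c \<longrightarrow>
       path_sum c ss = path_sum (\<lambda>x. c (s @ x)) rs)"
  using assms
proof (induction "length ss" arbitrary: s z z' ss rule: less_induct)
  case less
  define n where "n = length ss"
  have IH: "\<exists>rs. length rs \<le> length ts \<and> path u v z rs z' \<and>
    (\<forall>c :: 'a list \<Rightarrow> 'a list \<Rightarrow> 'g. invariant_weight u v c \<longrightarrow>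
       path_sum c ts = path_sum (\<lambda>x. c (s @ x)) rs)"
    if "length ts < n" "free_end s" "path u v (s @ z) ts (s @ z')" for ts s z z'
    using less(1) that unfolding n_def by blast
  from n_def less(2,3) show ?case
  proof (induction s arbitrary: ss)
    case Nil
    then show ?case by auto
  next
    case (Cons a s)
    show ?case
    proof (cases "\<forall>s \<in> set ss. fst s \<noteq> []")
      case True
      let ?ts = "map (\<lambda>(x, \<beta>, y). (tl x, \<beta>, y)) ss"
      have "path u v (a # (s @ z)) ss (a # (s @ z'))" using Cons.prems by simp
      note tl = path_tl[OF this True]
      have sum: "path_sum c ss = path_sum (\<lambda>x. c (a # x)) ?ts" for c :: "'a list \<Rightarrow> 'a list \<Rightarrow> 'g"
        using tl[of c] by blast
      have ts: "path u v (s @ z) ?ts (s @ z')" using tl by auto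
      have s: "free_end s" using Cons.prems free_end_ConsD by blast
      obtain rs where rs: "length rs \<le> length ss" "path u v z rs z'"
        and rs_sum: "\<And>c :: 'a list \<Rightarrow> 'a list \<Rightarrow> 'g. invariant_weight u v c \<Longrightarrow>
           path_sum c ?ts = path_sum (\<lambda>x. c (s @ x)) rs"
        using Cons.IH[OF _ s ts] Cons.prems(1) by auto
      have "path_sum c ss = path_sum (\<lambda>x. c ((a # s) @ x)) rs"
        if "invariant_weight u v c" for c :: "'a list \<Rightarrow> 'a list \<Rightarrow> 'g"
        using sum[of c] rs_sum[OF invariant_weight_shift[OF that, of "[a]"]] by simp
      with rs show ?thesis by blast
    next
      case False
      then obtain s1 y \<beta> s2 where ss: "ss = s1 @ ([], \<beta>, y) # s2" "\<forall>s \<in> set s1. fst s \<noteq> []"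
        using split_list_first_prop[of ss "\<lambda>s. fst s = []"] by force
      have "path u v ((a # s) @ z) s1 (relator u v \<beta> @ y)"
        using Cons.prems(3) by (auto simp: ss path_append)
      from path_head[OF this ss(2)] have "take (Suc (length p)) ((a # s) @ z) = p @ [if \<beta> then b else b']"
        using head_relator by simp
      \<comment> \<open>The first step at the left end exposes \<open>p\<close> in the initial word,
        so \<open>a # s\<close> is longer than \<open>p\<close> by \<open>free_end_length\<close>.
        Hence both ends share their first \<open>length p + 1\<close> letters, as
        \<open>path_shorten\<close> demands.\<close>
      then have "prefix p ((a # s) @ z)"
        by (metis prefixI append_assoc append_take_drop_id)
      with free_end_length Cons.prems(2) have len: "length p < length (a # s)" by blast
      have "\<exists>ts. length ts < length ss \<and> path u v ((a # s) @ z) ts ((a # s) @ z') \<and>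
        (\<forall>c :: 'a list \<Rightarrow> 'a list \<Rightarrow> 'g. invariant_weight u v c \<longrightarrow> path_sum c ts = path_sum c ss)"
        using IH len by (intro path_shorten Cons.prems False) (auto simp: Cons.prems(1))
      then obtain ts where ts: "length ts < length ss" "path u v ((a # s) @ z) ts ((a # s) @ z')"
        and ts_sum: "\<And>c :: 'a list \<Rightarrow> 'a list \<Rightarrow> 'g. invariant_weight u v c \<Longrightarrow> path_sum c ts = path_sum c ss"
        by blast
      obtain rs where "length rs \<le> length ts" "path u v z rs z'"
        "\<And>c :: 'a list \<Rightarrow> 'a list \<Rightarrow> 'g. invariant_weight u v c \<Longrightarrow>
           path_sum c ts = path_sum (\<lambda>x. c ((a # s) @ x)) rs"
        using IH[OF _ Cons.prems(2) ts(2)] ts(1) Cons.prems(1) by auto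
      with ts(1) ts_sum show ?thesis by (intro exI[of _ rs]) auto
    qed
  qed
qed

text \<open>The double induction of \<open>path_cancel\<close> again, now on the whole word. The
  heads required by \<open>path_shorten\<close> agree because the derivation is closed.\<close>

lemma path_sum_closed:
  fixes c :: "'a list \<Rightarrow> 'a list \<Rightarrow> 'g::ab_group_add"
  assumes "path u v w ss w" "invariant_weight u v c"
  shows "path_sum c ss = 0"
  using assms
proof (induction "length ss" arbitrary: w ss c rule: less_induct)
  case less
  define n where "n = length ss"
  have IH: "path_sum c ts = 0"
    if "length ts < n" "path u v w ts w" "invariant_weight u v c"
    for ts w and c :: "'a list \<Rightarrow> 'a list \<Rightarrow> 'g"
    using less(1) that unfolding n_def by blast
  from n_def less(2,3) show ?case
  proof (induction w arbitrary: ss c)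
    \<comment> \<open>Relators are nonempty, so no step starts at the empty word.\<close>
    case Nil
    then show ?case using u v by (cases ss) (auto simp: relator_def split: if_splits)
  next
    case (Cons a w)
    show ?case
    proof (cases "\<forall>s \<in> set ss. fst s \<noteq> []")
      case True
      then show ?thesis
        using path_tl[OF Cons.prems(2) True, of c] Cons.IH Cons.prems(1)
          invariant_weight_shift[OF Cons.prems(3), of "[a]"] by fastforce
    next
      case False
      have "\<exists>ts. length ts < length ss \<and> path u v (a # w) ts (a # w) \<and>
        (\<forall>c :: 'a list \<Rightarrow> 'a list \<Rightarrow> 'g. invariant_weight u v c \<longrightarrow> path_sum c ts = path_sum c ss)"
        by (rule path_shorten[OF path_cancel Cons.prems(2) _ False]) auto
      then show ?thesis using IH Cons.prems(1,3) by metis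
    qed
  qed
qed

end

text \<open>A nonempty prefix of the longest common prefix that is a suffix of one relator is, by the
  length assumption, a suffix of the longest common suffix, hence a common border.\<close>

lemma path_sum_closed_shorter_prefix:
  fixes c :: "'a list \<Rightarrow> 'a list \<Rightarrow> 'g::ab_group_add"
  assumes ne: "u \<noteq> []" "v \<noteq> []"
    and border: "\<And>r. r \<noteq> [] \<Longrightarrow> prefix r u \<Longrightarrow> prefix r v \<Longrightarrow> suffix r u \<Longrightarrow> \<not> suffix r v"
    and le: "length (longest_common_prefix u v) \<le> length (longest_common_prefix (rev u) (rev v))"
    and "path u v w ss w" "invariant_weight u v c"
  shows "path_sum c ss = 0"
proof -
  define p where "p = longest_common_prefix u v"
  let ?q = "longest_common_prefix (rev u) (rev v)"
  have pu: "prefix p u" and pv: "prefix p v"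
    by (simp_all add: p_def longest_common_prefix_prefix1 longest_common_prefix_prefix2)
  have q: "prefix ?q (rev u)" "prefix ?q (rev v)"
    by (simp_all add: longest_common_prefix_prefix1 longest_common_prefix_prefix2)
  have len: "length r \<le> length ?q" if "prefix r p" for r
    using that le prefix_length_le[OF that] by (simp add: p_def)
  have end_u: "\<not> suffix r u" if r: "r \<noteq> []" "prefix r p" for r
  proof
    assume "suffix r u"
    then have "prefix (rev r) ?q"
      using prefix_length_prefix[OF _ q(1), of "rev r"] len[OF r(2)] by (simp add: suffix_to_prefix)
    then have "suffix r v" using q(2) by (metis prefix_order.trans suffix_to_prefix)
    then show False
      using border[OF r(1)] \<open>suffix r u\<close> r(2) pu pv prefix_order.trans by blast
  qed
  have end_v: "\<not> suffix r v" if r: "r \<noteq> []" "prefix r p" for r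
  proof
    assume "suffix r v"
    then have "prefix (rev r) ?q"
      using prefix_length_prefix[OF _ q(2), of "rev r"] len[OF r(2)] by (simp add: suffix_to_prefix)
    then have "suffix r u" using q(1) by (metis prefix_order.trans suffix_to_prefix)
    then show False
      using end_u[OF r] by simp
  qed
  obtain x y where xy: "u = p @ x" "v = p @ y" using pu pv by (auto elim!: prefixE)
  \<comment> \<open>If \<open>x\<close> were empty, \<open>u = p\<close> would be a nonempty prefix
    of \<open>p\<close> and a suffix of \<open>u\<close>.\<close>
  have "x \<noteq> []" using end_u[of u] ne(1) xy by auto
  moreover have "y \<noteq> []" using end_v[of v] ne(2) xy by auto
  ultimately obtain b u' b' v' where bb: "x = b # u'" "y = b' # v'"
    by (metis list.exhaust)
  have "b \<noteq> b'"
  proof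
    assume "b = b'"
    then have "prefix (p @ [b]) (longest_common_prefix u v)"
      using xy bb by (intro longest_common_prefix_max_prefix) auto
    then have "prefix (p @ [b]) p" by (simp only: p_def)
    then show False by auto
  qed
  then interpret separated_relation u v p b b' u' v'
    using xy bb end_u end_v by unfold_locales auto
  show ?thesis by (rule path_sum_closed) fact+
qed

text \<open>Reversal exchanges prefixes with suffixes and preserves the absence of a common border,
  so the length assumption costs no generality. The weight is reversed along with its two arguments
  exchanged.\<close>

theorem path_sum_closed_no_common_border:
  fixes c :: "'a list \<Rightarrow> 'a list \<Rightarrow> 'g::ab_group_add"
  assumes ne: "u \<noteq> []" "v \<noteq> []"
    and border: "\<And>r. r \<noteq> [] \<Longrightarrow> prefix r u \<Longrightarrow> prefix r v \<Longrightarrow> suffix r u \<Longrightarrow> \<not> suffix r v"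
    and p: "path u v w ss w" and c: "invariant_weight u v c"
  shows "path_sum c ss = 0"
proof (cases "length (longest_common_prefix u v) \<le> length (longest_common_prefix (rev u) (rev v))")
  case True
  then show ?thesis using path_sum_closed_shorter_prefix assms by blast
next
  case False
  have "path_sum (\<lambda>x y. c (rev y) (rev x)) (map step_rev ss) = 0"
  proof (rule path_sum_closed_shorter_prefix)
    show "\<not> suffix r (rev v)"
      if "r \<noteq> []" "prefix r (rev u)" "prefix r (rev v)" "suffix r (rev u)" for r
      using border[of "rev r"] that by (auto simp: suffix_to_prefix)
  qed (use False ne path_rev[OF p] invariant_weight_rev[OF c] in auto)
  then show ?thesis by (simp add: path_sum_rev)
qed

section \<open>Free modules\<close>

definition basis_vector :: "('r, 'k) ring_scheme \<Rightarrow> 'p \<Rightarrow> 'p \<Rightarrow> 'r" where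
  "basis_vector R x = (\<lambda>y. if y = x then \<one>\<^bsub>R\<^esub> else \<zero>\<^bsub>R\<^esub>)"

lemma carrier_free_on_finite:
  assumes "finite B"
  shows "carrier (free_on R B) = {f. (\<forall>x. f x \<in> carrier R) \<and> (\<forall>x. x \<notin> B \<longrightarrow> f x = \<zero>\<^bsub>R\<^esub>)}"
  using assms by (auto simp: free_on_def intro: finite_subset)

lemma basis_vector_in_carrier:
  assumes "ring R" "x \<in> B" shows "basis_vector R x \<in> carrier (free_on R B)"
proof -
  interpret ring R by fact
  show ?thesis using assms(2) by (auto simp: free_on_def basis_vector_def)
qed

lemma finsum_free_on:
  assumes "ring R" "finite I" "g \<in> I \<rightarrow> carrier (free_on R B)"
  shows "finsum (free_on R B) g I y = finsum R (\<lambda>i. g i y) I"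
proof -
  interpret F: left_module R "free_on R B" by (rule left_module_free_on) fact
  have "g i y \<in> carrier R" if "i \<in> I" for i
    using funcset_mem[OF assms(3) that] by (auto simp: free_on_def)
  with assms(2,3) show ?thesis
    by (induction I) (simp_all add: Pi_iff, simp_all add: free_on_def)
qed

lemma free_on_expansion:
  assumes "ring R" "t \<in> carrier (free_on R B)"
  shows "finsum (free_on R B) (\<lambda>x. t x \<odot>\<^bsub>free_on R B\<^esub> basis_vector R x) {x. t x \<noteq> \<zero>\<^bsub>R\<^esub>} = t"
proof
  fix y
  interpret F: left_module R "free_on R B" by (rule left_module_free_on) fact
  let ?I = "{x. t x \<noteq> \<zero>\<^bsub>R\<^esub>}"
  have t: "finite ?I" "?I \<subseteq> B" "\<And>x. t x \<in> carrier R" using assms(2) by (auto simp: free_on_def)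
  have "(\<lambda>x. t x \<odot>\<^bsub>free_on R B\<^esub> basis_vector R x) \<in> ?I \<rightarrow> carrier (free_on R B)"
    using t basis_vector_in_carrier[OF assms(1), of _ B] by (intro funcsetI F.smult_closed) blast+
  then have "finsum (free_on R B) (\<lambda>x. t x \<odot>\<^bsub>free_on R B\<^esub> basis_vector R x) ?I y
      = finsum R (\<lambda>x. (t x \<odot>\<^bsub>free_on R B\<^esub> basis_vector R x) y) ?I"
    by (rule finsum_free_on[OF assms(1) t(1)])
  also have "\<dots> = finsum R (\<lambda>x. if y = x then t y else \<zero>\<^bsub>R\<^esub>) ?I"
    using t(3) by (intro F.R.finsum_cong') (auto simp: free_on_def basis_vector_def)
  also have "\<dots> = t y"
  proof (cases "y \<in> ?I")
    case True
    then show ?thesis using F.R.finsum_singleton[of y ?I "\<lambda>_. t y"] t by auto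
  next
    case False
    then have "finsum R (\<lambda>x. if y = x then t y else \<zero>\<^bsub>R\<^esub>) ?I = finsum R (\<lambda>x. \<zero>\<^bsub>R\<^esub>) ?I"
      by (intro F.R.finsum_cong') auto
    then show ?thesis using False by simp
  qed
  finally show "finsum (free_on R B) (\<lambda>x. t x \<odot>\<^bsub>free_on R B\<^esub> basis_vector R x) ?I y = t y" .
qed

text \<open>Preimages of the images of the basis vectors are chosen and extended linearly by
  \<open>free_eval\<close>; \<open>free_on_expansion\<close> shows that this is a lift.\<close>

lemma projective_module_free_on:
  fixes R :: "('r, 'k) ring_scheme" and B :: "'p set"
  assumes R: "ring R"
  shows "projective_module R (free_on R B)"
  unfolding projective_module_def
proof (intro conjI allI impI left_module_free_on[OF R])
  let ?F = "free_on R B"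
  fix N :: "('r, ('p \<Rightarrow> 'r) \<Rightarrow> 'r) module" and L :: "('r, 'p \<Rightarrow> 'r) module" and g f
  assume "left_module R N \<and> left_module R L \<and>
    g \<in> lmod_hom R N L \<and> g ` carrier N = carrier L \<and> f \<in> lmod_hom R ?F L"
  then have N: "left_module R N" and L: "left_module R L"
    and g: "g \<in> lmod_hom R N L" "g ` carrier N = carrier L" and f: "f \<in> lmod_hom R ?F L"
    by auto
  interpret N: left_module R N by fact
  interpret L: left_module R L by fact
  interpret F: left_module R ?F by (rule left_module_free_on) fact
  have "\<exists>n \<in> carrier N. g n = f (basis_vector R x)" if "x \<in> B" for x
  proof -
    have "f (basis_vector R x) \<in> carrier L"
      using f basis_vector_in_carrier[OF R that] by (auto simp: lmod_hom_def hom_def)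
    then show ?thesis using g(2) by (metis imageE)
  qed
  then obtain n where n: "\<And>x. x \<in> B \<Longrightarrow> n x \<in> carrier N" "\<And>x. x \<in> B \<Longrightarrow> g (n x) = f (basis_vector R x)"
    by metis
  have "g (free_eval R N n t) = f t" if t: "t \<in> carrier ?F" for t
  proof -
    let ?I = "{x. t x \<noteq> \<zero>\<^bsub>R\<^esub>}"
    have I: "finite ?I" "?I \<subseteq> B" "\<And>x. t x \<in> carrier R" using t by (auto simp: free_on_def)
    have bv: "basis_vector R x \<in> carrier ?F" if "x \<in> ?I" for x
      using basis_vector_in_carrier[OF R, of x B] I(2) that by blast
    have "g (free_eval R N n t) = finsum L (\<lambda>x. g (t x \<odot>\<^bsub>N\<^esub> n x)) ?I"
      unfolding free_eval_def by (rule lmod_hom_finsum[OF N L g(1) I(1)]) (use I n in auto)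
    also have "\<dots> = finsum L (\<lambda>x. f (t x \<odot>\<^bsub>?F\<^esub> basis_vector R x)) ?I"
    proof (rule L.finsum_cong')
      show "g (t x \<odot>\<^bsub>N\<^esub> n x) = f (t x \<odot>\<^bsub>?F\<^esub> basis_vector R x)" if "x \<in> ?I" for x
        using that I n[of x] g(1) f bv[OF that] unfolding lmod_hom_def by auto
      show "(\<lambda>x. f (t x \<odot>\<^bsub>?F\<^esub> basis_vector R x)) \<in> ?I \<rightarrow> carrier L"
        using f I bv by (auto simp: lmod_hom_def hom_def)
    qed simp
    also have "\<dots> = f (finsum ?F (\<lambda>x. t x \<odot>\<^bsub>?F\<^esub> basis_vector R x) ?I)"
      by (rule lmod_hom_finsum[OF left_module_free_on[OF R] L f I(1), symmetric]) (use I bv in auto)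
    finally show ?thesis by (simp add: free_on_expansion[OF R t])
  qed
  moreover have "free_eval R N n \<in> lmod_hom R ?F N"
    by (rule free_eval_hom[OF N]) (use n in auto)
  ultimately show "\<exists>h \<in> lmod_hom R ?F N. \<forall>x \<in> carrier ?F. g (h x) = f x" by blast
qed

lemma fin_gen_free_on:
  assumes R: "ring R" and B: "finite B"
  shows "fin_gen R (free_on R B)"
  unfolding fin_gen_def
proof (intro exI[of _ "basis_vector R ` B"] conjI allI impI)
  let ?F = "free_on R B"
  interpret F: left_module R ?F by (rule left_module_free_on) fact
  show "basis_vector R ` B \<subseteq> carrier ?F" using basis_vector_in_carrier[OF R, of _ B] by auto
  fix H assume "submodule H R ?F \<and> basis_vector R ` B \<subseteq> H"
  then have "submodule H R ?F" and gen: "basis_vector R ` B \<subseteq> H" by auto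
  then interpret H: submodule H R ?F by simp
  have "t \<in> H" if t: "t \<in> carrier ?F" for t
  proof -
    have I: "finite {x. t x \<noteq> \<zero>\<^bsub>R\<^esub>}" "{x. t x \<noteq> \<zero>\<^bsub>R\<^esub>} \<subseteq> B" "\<And>x. t x \<in> carrier R"
      using t by (auto simp: free_on_def)
    have "finsum ?F (\<lambda>x. t x \<odot>\<^bsub>?F\<^esub> basis_vector R x) I \<in> H" if "finite I" "I \<subseteq> B" for I
      using that
    proof (induction I)
      case empty
      \<comment> \<open>A submodule is a subgroup of the additive group, whose unit is the zero
        vector.\<close>
      then show ?case using H.one_closed by simp
    next
      case (insert i I)
      have *: "t x \<odot>\<^bsub>?F\<^esub> basis_vector R x \<in> H" if "x \<in> B" for x
        using that I(3) gen by (intro H.smult_closed) auto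
      then have "t x \<odot>\<^bsub>?F\<^esub> basis_vector R x \<in> carrier ?F" if "x \<in> B" for x
        using that H.subset by auto
      then show ?case
        using insert * H.m_closed by (subst F.M.finsum_insert) (auto simp: subset_iff)
    qed
    from this[OF I(1,2)] show ?thesis by (simp add: free_on_expansion[OF R t])
  qed
  then show "H = carrier ?F" using H.subset by auto
qed (use B in auto)

section \<open>The bimodule resolution\<close>

text \<open>Symmetry inverts a derivation and transitivity concatenates two. For a product the left
  factor is rewritten first, then the right one.\<close>

lemma pres_cong_imp_path:
  "pres_cong A {(u, v)} w w' \<Longrightarrow> \<exists>ss. path u v w ss w'"
proof (induction rule: pres_cong.induct)
  case (base x y)
  then show ?case by (intro exI[of _ "[([], True, [])]"]) (auto simp: relator_def)
next
  case (refl x)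
  then show ?case by (metis path.simps(1))
next
  case (sym x y)
  then show ?case by (metis path_inverse)
next
  case (trans x y z)
  then show ?case by (metis path_append)
next
  case (mult x y x' y')
  then obtain ss ts where "path u v x ss y" "path u v x' ts y'" by blast
  then have "path u v (x @ x') (map (step_extend [] x') ss @ map (step_extend y []) ts) (y @ y')"
    unfolding path_append
    using path_extend[of u v x ss y "[]" x'] path_extend[of u v x' ts y' y "[]"] by auto
  then show ?case by blast
qed

lemma frag_extend_induction_eq:
  assumes "Poly_Mapping.keys g \<subseteq> S"
    and "\<And>a b. F (a - b) = F a - F b" "\<And>a b. G (a - b) = G a - G b"
    and "\<And>x. x \<in> S \<Longrightarrow> F (frag_of x) = G (frag_of x)"
  shows "F (g :: 'x \<Rightarrow>\<^sub>0 int) = (G g :: 'b::ab_group_add)"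
  using assms(1)
proof (induction g rule: frag_induction)
  case zero
  show ?case using assms(2)[of 0 0] assms(3)[of 0 0] by simp
qed (simp_all add: assms(2-4))

lemma biext_sum_left: "biext c (\<Sum>i\<in>I. f i) g = (\<Sum>i\<in>I. biext c (f i) g)"
  by (induction I rule: infinite_finite_induct) (simp_all add: biext_add_left)

lemma biext_sum_right: "biext c f (\<Sum>i\<in>I. g i) = (\<Sum>i\<in>I. biext c f (g i))"
  by (induction I rule: infinite_finite_induct) (simp_all add: biext_add_right)

text \<open>The index type that \<open>type_FP_infinity\<close> and
  \<open>projective_dimension\<close> prescribe for the resolving modules of
  \<open>bimodule_ZM\<close>.\<close>

type_synonym 'b index = "nat \<times> ('b list set \<Rightarrow>\<^sub>0 int)"

locale incompressible_presentation =
  fixes A :: "'a set" and u v :: "'a list"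
  assumes finite_A: "finite A"
    and u: "u \<in> lists A" "u \<noteq> []" and v: "v \<in> lists A" "v \<noteq> []"
    and incompressible: "incompressible A u v"
begin

section \<open>The presented monoid: classes and representatives\<close>

abbreviation M where "M \<equiv> one_relator_monoid A u v"
abbreviation R where "R \<equiv> bimonoid_ring M"
abbreviation cl where "cl \<equiv> pres_class A {(u, v)}"
abbreviation ring_prod (infixl \<open>\<star>\<close> 70) where "f \<star> g \<equiv> f \<otimes>\<^bsub>R\<^esub> g"

text \<open>An arbitrary section of the projection from words to \<open>M\<close>. Its use rests on
  asphericity, not on any confluence.\<close>

definition nf :: "'a list set \<Rightarrow> 'a list" where
  "nf m = (SOME w. w \<in> lists A \<and> cl w = m)"

text \<open>The basis element x \<otimes> y, with the bimonoid ring seen as ZM \<otimes> ZM.\<close>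

definition gen :: "'a list \<Rightarrow> 'a list \<Rightarrow> ('a list set \<times> 'a list set \<Rightarrow>\<^sub>0 int)" where
  "gen x y = frag_of (cl x, cl y)"

lemma nf: "m \<in> carrier M \<Longrightarrow> nf m \<in> lists A" "m \<in> carrier M \<Longrightarrow> cl (nf m) = m"
  unfolding nf_def by (rule someI2_ex; auto simp: presented_monoid_def)+

lemma cl_in_carrier [simp]: "w \<in> lists A \<Longrightarrow> cl w \<in> carrier M"
  by (simp add: presented_monoid_def)

lemma nf_cl: "w \<in> lists A \<Longrightarrow> nf (cl w) \<in> lists A" "w \<in> lists A \<Longrightarrow> cl (nf (cl w)) = cl w"
  by (simp_all add: nf)

lemma cl_append_cong:
  assumes "cl x = cl x'" "cl y = cl y'" "x \<in> lists A" "y \<in> lists A" "x' \<in> lists A" "y' \<in> lists A"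
  shows "cl (x @ y) = cl (x' @ y')"
  using assms pres_class_mult by metis

text \<open>\<open>invariant_weight\<close> quantifies over all words, also those with letters
  outside \<open>A\<close>; their classes are empty and hence agree.\<close>

lemma cl_outside: "w \<notin> lists A \<Longrightarrow> cl w = {}"
  by (auto simp: pres_class_def dest: pres_cong_lists)

lemma cl_relation: "cl (x @ u @ y) = cl (x @ v @ y)"
proof (cases "x \<in> lists A \<and> y \<in> lists A")
  case True
  have "pres_cong A {(u, v)} u v" using u v by (simp add: pres_cong.base)
  then have "cl u = cl v" using u by (simp add: pres_class_eq_iff)
  then show ?thesis
    using True u v by (intro cl_append_cong) auto
next
  case False
  then have "x @ u @ y \<notin> lists A" "x @ v @ y \<notin> lists A" by auto
  then show ?thesis using cl_outside by metis
qed

lemma gen_cong: "cl x = cl x' \<Longrightarrow> cl y = cl y' \<Longrightarrow> gen x y = gen x' y'"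
  by (simp add: gen_def)

lemma invariant_gen: "invariant_weight u v (\<lambda>x y. gen x (y @ z))"
  using cl_relation unfolding invariant_weight_def gen_def by (metis append.assoc)

lemma cl_eq_path: "cl w = cl w' \<Longrightarrow> w \<in> lists A \<Longrightarrow> \<exists>ss. path u v w ss w'"
  using pres_class_eq_iff pres_cong_imp_path by metis

section \<open>Sums along derivations with weight \<open>gen\<close>\<close>

lemma path_cl_eq:
  assumes "path u v w ss w'" shows "cl w = cl w'"
proof -
  have "invariant_weight u v (\<lambda>x y. (cl x, cl y))"
    by (simp add: invariant_weight_def cl_relation)
  from invariant_weight_path(1)[OF this assms] show ?thesis by simp
qed

lemma path_sum_closed_gen:
  assumes "path u v w ss w" shows "path_sum (\<lambda>x y. gen x (y @ z)) ss = 0"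
proof (rule path_sum_closed_no_common_border[OF u(2) v(2) _ assms invariant_gen])
  show "\<not> suffix r v" if "r \<noteq> []" "prefix r u" "prefix r v" "suffix r u" for r
  proof
    assume "suffix r v"
    moreover have "r \<in> lists A" using that(2) u(1) by (auto elim: prefixE)
    ultimately show False using that incompressible u v unfolding incompressible_def by auto
  qed
qed

text \<open>Going along \<open>ss\<close> and back along \<open>ts\<close> is a closed derivation,
  so asphericity applies.\<close>

lemma path_sum_unique:
  assumes "path u v w ss w'" "path u v w ts w'"
  shows "path_sum (\<lambda>x y. gen x (y @ z)) ss = path_sum (\<lambda>x y. gen x (y @ z)) ts"
proof -
  have "path u v w (ss @ rev (map step_inverse ts)) w"
    unfolding path_append using assms path_inverse by blast
  from path_sum_closed_gen[OF this] show ?thesis by (simp add: path_sum_inverse)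
qed

text \<open>By \<open>path_sum_unique\<close> the chosen derivation to the representative does not
  matter. The word \<open>z\<close> records the right factor.\<close>

definition trace :: "'a list \<Rightarrow> 'a list \<Rightarrow> ('a list set \<times> 'a list set \<Rightarrow>\<^sub>0 int)" where
  "trace w z = path_sum (\<lambda>x y. gen x (y @ z)) (SOME ss. path u v w ss (nf (cl w)))"

lemma trace_eq:
  assumes "path u v w ss (nf (cl w))"
  shows "trace w z = path_sum (\<lambda>x y. gen x (y @ z)) ss"
  unfolding trace_def using someI_ex[of "\<lambda>ss. path u v w ss (nf (cl w))"] path_sum_unique assms by blast

lemma trace_path:
  assumes "w \<in> lists A" "path u v w ss w'"
  shows "trace w z = path_sum (\<lambda>x y. gen x (y @ z)) ss + trace w' z"
proof -
  have eq: "cl w' = cl w" using path_cl_eq[OF assms(2)] by simp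
  then have "w' \<in> lists A" using assms(1) by (metis cl_outside pres_class_def mem_Collect_eq pres_cong.refl empty_iff)
  then obtain ts where ts: "path u v w' ts (nf (cl w'))"
    using cl_eq_path[of w' "nf (cl w')"] nf_cl by metis
  then have "path u v w (ss @ ts) (nf (cl w))" unfolding path_append using assms(2) eq by auto
  from trace_eq[OF this] show ?thesis by (simp add: trace_eq[OF ts])
qed

lemma trace_nf:
  assumes "w \<in> lists A" shows "trace (nf (cl w)) z = 0"
  using trace_eq[of "nf (cl w)" "[]" z] nf_cl[OF assms] by simp

lemma trace_cong:
  assumes "cl z = cl z'" "z \<in> lists A" "z' \<in> lists A"
  shows "trace w z = trace w z'"
proof -
  have "gen x (y @ z) = gen x (y @ z')" for x y
  proof (cases "y \<in> lists A")
    case True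
    then show ?thesis using assms by (intro gen_cong cl_append_cong) auto
  next
    case False
    then have "y @ z \<notin> lists A" "y @ z' \<notin> lists A" by auto
    then show ?thesis using cl_outside gen_cong by metis
  qed
  then show ?thesis unfolding trace_def by simp
qed

section \<open>Arithmetic in the bimonoid ring\<close>

lemma carrier_R: "carrier R = {f. Poly_Mapping.keys f \<subseteq> carrier M \<times> carrier M}"
  by (simp add: bimonoid_ring_def monoid_ring_def opposite_monoid_def)

lemma R_simps: "\<zero>\<^bsub>R\<^esub> = 0" "f \<oplus>\<^bsub>R\<^esub> g = f + g" "\<one>\<^bsub>R\<^esub> = gen [] []"
  by (simp_all add: bimonoid_ring_def monoid_ring_def gen_def opposite_monoid_def presented_monoid_def)

lemma mult_R: "f \<star> g = biext (\<lambda>p q. p \<otimes>\<^bsub>M \<times>\<times> opposite_monoid M\<^esub> q) f g"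
  by (simp add: bimonoid_ring_def monoid_ring_def)

lemma ring_R: "ring R"
  unfolding bimonoid_ring_def
  by (intro ring_monoid_ring DirProd_monoid monoid_opposite_monoid monoid_presented_monoid)

sublocale R: ring R by (rule ring_R)

lemma prod_distrib:
  "(f + f') \<star> g = f \<star> g + f' \<star> g" "f \<star> (g + g') = f \<star> g + f \<star> g'"
  "(f - f') \<star> g = f \<star> g - f' \<star> g" "f \<star> (g - g') = f \<star> g - f \<star> g'"
  "0 \<star> g = 0" "f \<star> 0 = 0"
  by (simp_all add: mult_R biext_add_left biext_add_right biext_diff_left biext_diff_right)

lemma prod_sum:
  "(\<Sum>i\<in>I. f i) \<star> g = (\<Sum>i\<in>I. f i \<star> g)" "h \<star> (\<Sum>i\<in>I. f i) = (\<Sum>i\<in>I. h \<star> f i)"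
  by (simp_all add: mult_R biext_sum_left biext_sum_right)

text \<open>The second component multiplies in the opposite monoid, whence
  \<open>y' @ y\<close>.\<close>

lemma gen_prod:
  assumes "x \<in> lists A" "y \<in> lists A" "x' \<in> lists A" "y' \<in> lists A"
  shows "gen x y \<star> gen x' y' = gen (x @ x') (y' @ y)"
  using assms by (simp add: gen_def mult_R opposite_monoid_def pres_class_mult)

lemma carrier_R_closed:
  "0 \<in> carrier R" "f \<in> carrier R \<Longrightarrow> g \<in> carrier R \<Longrightarrow> f + g \<in> carrier R"
  "f \<in> carrier R \<Longrightarrow> g \<in> carrier R \<Longrightarrow> f - g \<in> carrier R" "f \<in> carrier R \<Longrightarrow> - f \<in> carrier R"
  using keys_add[of f g] keys_diff[of f g] unfolding carrier_R by auto

lemma sum_in_carrier_R: "(\<And>i. i \<in> I \<Longrightarrow> f i \<in> carrier R) \<Longrightarrow> (\<Sum>i\<in>I. f i) \<in> carrier R"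
  by (induction I rule: infinite_finite_induct) (simp_all add: carrier_R_closed)

lemma gen_in_carrier: "x \<in> lists A \<Longrightarrow> y \<in> lists A \<Longrightarrow> gen x y \<in> carrier R"
  by (simp add: carrier_R gen_def)

text \<open>The elements x \<otimes> y with words over \<open>A\<close> exhaust the additive basis
  of \<open>R\<close>, so identities between additive maps are checked on them.\<close>

lemma carrier_R_eqI:
  assumes "g \<in> carrier R"
    and "\<And>a b. F (a - b) = F a - F b" "\<And>a b. G (a - b) = G a - G b"
    and "\<And>x y. x \<in> lists A \<Longrightarrow> y \<in> lists A \<Longrightarrow> F (gen x y) = G (gen x y)"
  shows "F g = (G g :: 'b::ab_group_add)"
proof (rule frag_extend_induction_eq[where S = "carrier M \<times> carrier M"])
  show "Poly_Mapping.keys g \<subseteq> carrier M \<times> carrier M" using assms(1) by (simp add: carrier_R)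
  show "F (frag_of x) = G (frag_of x)" if "x \<in> carrier M \<times> carrier M" for x
    using assms(4)[of "nf (fst x)" "nf (snd x)"] that by (auto simp: gen_def nf)
qed fact+

subsection \<open>Fox derivatives\<close>

text \<open>\<open>fox a x w z\<close> is the sum of \<open>x w\<^sub>1 \<otimes> w\<^sub>2 z\<close> over all factorisations \<open>w = w\<^sub>1 a w\<^sub>2\<close>.\<close>

primrec fox :: "'a \<Rightarrow> 'a list \<Rightarrow> 'a list \<Rightarrow> 'a list \<Rightarrow> ('a list set \<times> 'a list set \<Rightarrow>\<^sub>0 int)" where
  "fox a x [] z = 0"
| "fox a x (c # w) z = (if c = a then gen x (w @ z) else 0) + fox a (x @ [c]) w z"

text \<open>The Leibniz rule of Fox calculus.\<close>

lemma fox_append: "fox a x (w @ w') z = fox a x w (w' @ z) + fox a (x @ w) w' z"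
  by (induction w arbitrary: x) (simp_all add: algebra_simps)

lemma fox_cong:
  assumes "cl x = cl x'" "cl z = cl z'" "w \<in> lists A"
    "x \<in> lists A" "x' \<in> lists A" "z \<in> lists A" "z' \<in> lists A"
  shows "fox a x w z = fox a x' w z'"
  using assms
proof (induction w arbitrary: x x')
  case (Cons c w)
  have "gen x (w @ z) = gen x' (w @ z')"
    using Cons.prems by (intro gen_cong cl_append_cong) auto
  moreover have "fox a (x @ [c]) w z = fox a (x' @ [c]) w z'"
    using Cons.prems by (intro Cons.IH cl_append_cong) auto
  ultimately show ?case by simp
qed simp

lemma fox_in_carrier:
  "x \<in> lists A \<Longrightarrow> w \<in> lists A \<Longrightarrow> z \<in> lists A \<Longrightarrow> fox a x w z \<in> carrier R"
  by (induction w arbitrary: x) (simp_all add: carrier_R_closed gen_in_carrier)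

lemma gen_prod_fox:
  assumes "x \<in> lists A" "z \<in> lists A" "x' \<in> lists A" "w \<in> lists A" "z' \<in> lists A"
  shows "gen x z \<star> fox a x' w z' = fox a (x @ x') w (z' @ z)"
  using assms(3,4)
  by (induction w arbitrary: x') (simp_all add: prod_distrib gen_prod assms)

text \<open>Image of the generator for the letter \<open>a\<close> under the boundary from degree 1
  to degree 0.\<close>

definition bdry1 :: "'a \<Rightarrow> ('a list set \<times> 'a list set \<Rightarrow>\<^sub>0 int)" where
  "bdry1 a = gen [a] [] - gen [] [a]"

text \<open>Coordinate at \<open>a\<close> of the image of the generator for the relation under the
  boundary from degree 2 to degree 1.\<close>

definition bdry2 :: "'a \<Rightarrow> ('a list set \<times> 'a list set \<Rightarrow>\<^sub>0 int)" where
  "bdry2 a = fox a [] u [] - fox a [] v []"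

lemma gen_prod_bdry1:
  "x \<in> lists A \<Longrightarrow> z \<in> lists A \<Longrightarrow> a \<in> A \<Longrightarrow> gen x z \<star> bdry1 a = gen (x @ [a]) z - gen x (a # z)"
  by (simp add: bdry1_def prod_distrib gen_prod)

lemma gen_prod_bdry2:
  "x \<in> lists A \<Longrightarrow> z \<in> lists A \<Longrightarrow> gen x z \<star> bdry2 a = fox a x u z - fox a x v z"
  using u v by (simp add: bdry2_def prod_distrib gen_prod_fox)

text \<open>The fundamental formula of Fox calculus: moving one letter at a time across the tensor
  sign gives a telescoping sum.\<close>

lemma fox_bdry1:
  assumes "x \<in> lists A" "w \<in> lists A" "z \<in> lists A"
  shows "(\<Sum>a\<in>A. fox a x w z \<star> bdry1 a) = gen (x @ w) z - gen x (w @ z)"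
  using assms(1,2)
proof (induction w arbitrary: x)
  case (Cons c w)
  have "(\<Sum>a\<in>A. fox a x (c # w) z \<star> bdry1 a)
      = (\<Sum>a\<in>A. (if c = a then gen x (w @ z) \<star> bdry1 a else 0) + fox a (x @ [c]) w z \<star> bdry1 a)"
    by (intro sum.cong) (auto simp: prod_distrib)
  also have "\<dots> = gen x (w @ z) \<star> bdry1 c + (gen (x @ [c] @ w) z - gen (x @ [c]) (w @ z))"
    using Cons finite_A by (simp add: sum.distrib)
  also have "\<dots> = gen (x @ c # w) z - gen x (c # w @ z)"
    using Cons.prems assms(3) by (simp add: gen_prod_bdry1)
  finally show ?case by simp
qed (simp add: prod_distrib)

text \<open>Each step contributes the change of the Fox derivative that it causes, and these changes
  telescope.\<close>

lemma path_sum_bdry2: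
  assumes "path u v w ss w'" "w \<in> lists A" "z \<in> lists A"
  shows "path_sum (\<lambda>x y. gen x (y @ z)) ss \<star> bdry2 a = fox a [] w z - fox a [] w' z"
  using assms(1,2)
proof (induction ss arbitrary: w)
  case (Cons s ss)
  obtain x \<beta> y where s: "s = (x, \<beta>, y)" by (cases s)
  with Cons.prems have w: "w = x @ relator u v \<beta> @ y" "x \<in> lists A" "y \<in> lists A"
    and p: "path u v (x @ relator u v (\<not> \<beta>) @ y) ss w'" by auto
  have rel: "relator u v \<gamma> \<in> lists A" for \<gamma> using u v by (simp add: relator_def)
  \<comment> \<open>The derivatives of \<open>x\<close> and \<open>y\<close> see the relator only
    through its class, so only the derivative of the relator itself changes.\<close>
  have "fox a [] x (u @ y @ z) = fox a [] x (v @ y @ z)"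
    "fox a (x @ u) y z = fox a (x @ v) y z"
    using w u v assms(3) cl_relation[of x "[]"] cl_relation[of "[]" "y @ z"]
    by (auto intro!: fox_cong)
  then have "fox a [] (x @ u @ y) z - fox a [] (x @ v @ y) z = fox a x u (y @ z) - fox a x v (y @ z)"
    by (simp add: fox_append)
  also have "\<dots> = gen x (y @ z) \<star> bdry2 a"
    using w assms(3) by (simp add: gen_prod_bdry2)
  finally have "gen x (y @ z) \<star> bdry2 a = fox a [] (x @ u @ y) z - fox a [] (x @ v @ y) z" ..
  moreover have "path_sum (\<lambda>x y. gen x (y @ z)) ss \<star> bdry2 a
      = fox a [] (x @ relator u v (\<not> \<beta>) @ y) z - fox a [] w' z"
    using p w rel by (intro Cons.IH) auto
  moreover have "(- g) \<star> h = - (g \<star> h)" for g h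
    using prod_distrib(3)[of 0 g h] by (simp add: prod_distrib)
  ultimately show ?case
    by (cases \<beta>) (simp_all add: s w prod_distrib relator_def)
qed (simp add: prod_distrib)

subsection \<open>The contracting homotopy\<close>

text \<open>Component at \<open>a\<close> of the homotopy from degree 0 to degree 1. It is merely
  additive, which suffices for exactness.\<close>

definition htpy0 :: "'a \<Rightarrow> ('a list set \<times> 'a list set \<Rightarrow>\<^sub>0 int) \<Rightarrow> ('a list set \<times> 'a list set \<Rightarrow>\<^sub>0 int)" where
  "htpy0 a = frag_extend (\<lambda>(m, n). fox a [] (nf m) (nf n))"

text \<open>The homotopy from degree 1 to degree 2 on the summand of \<open>a\<close>: the
  derivation from \<open>nf m @ [a]\<close> to its representative.\<close>

definition htpy1 :: "'a \<Rightarrow> ('a list set \<times> 'a list set \<Rightarrow>\<^sub>0 int) \<Rightarrow> ('a list set \<times> 'a list set \<Rightarrow>\<^sub>0 int)" where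
  "htpy1 a = frag_extend (\<lambda>(m, n). trace (nf m @ [a]) (nf n))"

lemma htpy0_gen:
  assumes "x \<in> lists A" "z \<in> lists A"
  shows "htpy0 a (gen x z) = fox a [] (nf (cl x)) z"
proof -
  have "htpy0 a (gen x z) = fox a [] (nf (cl x)) (nf (cl z))" by (simp add: htpy0_def gen_def)
  also have "\<dots> = fox a [] (nf (cl x)) z"
    by (rule fox_cong) (simp_all add: nf_cl assms del: in_lists_conv_set)
  finally show ?thesis .
qed

lemma htpy1_gen:
  assumes "x \<in> lists A" "z \<in> lists A"
  shows "htpy1 a (gen x z) = trace (nf (cl x) @ [a]) z"
proof -
  have "htpy1 a (gen x z) = trace (nf (cl x) @ [a]) (nf (cl z))" by (simp add: htpy1_def gen_def)
  also have "\<dots> = trace (nf (cl x) @ [a]) z"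
    by (rule trace_cong) (simp_all add: nf_cl assms del: in_lists_conv_set)
  finally show ?thesis .
qed

lemma htpy_diff:
  "htpy0 a (f - g) = htpy0 a f - htpy0 a g" "htpy1 a (f - g) = htpy1 a f - htpy1 a g"
  by (simp_all add: htpy0_def htpy1_def frag_extend_diff)

lemma htpy_add:
  "htpy0 a (f + g) = htpy0 a f + htpy0 a g" "htpy1 a (f + g) = htpy1 a f + htpy1 a g"
  "htpy0 a 0 = 0" "htpy1 a 0 = 0"
  by (simp_all add: htpy0_def htpy1_def frag_extend_add)

lemma htpy0_sum: "htpy0 a (\<Sum>i\<in>I. f i) = (\<Sum>i\<in>I. htpy0 a (f i))"
  by (induction I rule: infinite_finite_induct) (simp_all add: htpy_add)

lemma ex_path_nf:
  assumes "w \<in> lists A" shows "\<exists>ss. path u v w ss (nf (cl w))"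
  using cl_eq_path nf_cl assms by metis

lemma path_sum_in_carrier:
  assumes "path u v w ss w'" "w \<in> lists A" "z \<in> lists A"
  shows "path_sum (\<lambda>x y. gen x (y @ z)) ss \<in> carrier R"
  using assms(1,2)
proof (induction ss arbitrary: w)
  case (Cons s ss)
  obtain x \<beta> y where s: "s = (x, \<beta>, y)" by (cases s)
  with Cons.prems have w: "x \<in> lists A" "y \<in> lists A"
    and p: "path u v (x @ relator u v (\<not> \<beta>) @ y) ss w'" by auto
  have rel: "relator u v \<gamma> \<in> lists A" for \<gamma> using u v by (simp add: relator_def)
  have "path_sum (\<lambda>x y. gen x (y @ z)) ss \<in> carrier R"
    using w rel[of "\<not> \<beta>"] by (intro Cons.IH[OF p]) auto
  moreover have "gen x (y @ z) \<in> carrier R" using w assms(3) by (intro gen_in_carrier) auto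
  ultimately show ?case by (auto simp: s carrier_R_closed)
qed (simp add: carrier_R_closed)

lemma trace_in_carrier:
  assumes "w \<in> lists A" "z \<in> lists A" shows "trace w z \<in> carrier R"
  using ex_path_nf[OF assms(1)] trace_eq path_sum_in_carrier assms by metis

lemma frag_extend_in_carrier:
  assumes "f \<in> carrier R" "\<And>m n. m \<in> carrier M \<Longrightarrow> n \<in> carrier M \<Longrightarrow> F (m, n) \<in> carrier R"
  shows "frag_extend F f \<in> carrier R"
  using assms keys_frag_extend[of F f] unfolding carrier_R by fastforce

lemma htpy0_in_carrier: "f \<in> carrier R \<Longrightarrow> htpy0 a f \<in> carrier R"
  unfolding htpy0_def by (erule frag_extend_in_carrier) (simp add: fox_in_carrier nf del: in_lists_conv_set)

lemma htpy1_in_carrier: "f \<in> carrier R \<Longrightarrow> a \<in> A \<Longrightarrow> htpy1 a f \<in> carrier R"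
  unfolding htpy1_def by (erule frag_extend_in_carrier) (simp add: trace_in_carrier nf del: in_lists_conv_set)

text \<open>The word \<open>nf (cl x) @ w\<close> is normalised by absorbing the letters of
  \<open>w\<close> one after another; the sum collects these partial derivations.\<close>

lemma htpy1_fox:
  assumes "x \<in> lists A" "w \<in> lists A" "z \<in> lists A"
  shows "(\<Sum>a\<in>A. htpy1 a (fox a x w z)) = trace (nf (cl x) @ w) z"
  using assms(1,2)
proof (induction w arbitrary: x)
  case Nil
  then show ?case by (simp add: htpy_add trace_nf)
next
  case (Cons c w)
  let ?n = "nf (cl x)"
  have c: "c \<in> A" "w \<in> lists A" "?n @ [c] \<in> lists A" "?n @ c # w \<in> lists A"
    using Cons.prems nf_cl by auto
  have xc: "cl (?n @ [c]) = cl (x @ [c])"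
    using Cons.prems nf_cl by (intro cl_append_cong) auto
  obtain ss where ss: "path u v (?n @ [c]) ss (nf (cl (x @ [c])))"
    using ex_path_nf[OF c(3)] xc by auto
  \<comment> \<open>The first letter is absorbed while \<open>w\<close> stands by as right
    context.\<close>
  have ext: "path u v (?n @ c # w) (map (step_extend [] w) ss) (nf (cl (x @ [c])) @ w)"
    using path_extend[OF ss, of "[]" w] by simp
  have "(\<Sum>a\<in>A. htpy1 a (fox a x (c # w) z))
      = (\<Sum>a\<in>A. (if c = a then htpy1 a (gen x (w @ z)) else 0) + htpy1 a (fox a (x @ [c]) w z))"
    by (intro sum.cong) (auto simp: htpy_add)
  also have "\<dots> = htpy1 c (gen x (w @ z)) + trace (nf (cl (x @ [c])) @ w) z"
    using Cons finite_A by (simp add: sum.distrib)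
  also have "htpy1 c (gen x (w @ z)) = trace (?n @ [c]) (w @ z)"
    using Cons.prems assms(3) by (intro htpy1_gen) auto
  also have "trace (?n @ [c]) (w @ z) + trace (nf (cl (x @ [c])) @ w) z = trace (?n @ c # w) z"
    using trace_eq[of "?n @ [c]" ss "w @ z"] ss xc trace_path[OF c(4) ext, of z]
    by (simp add: path_sum_extend)
  finally show ?case .
qed

text \<open>The homotopy identity in degree 2, where only one composite occurs.\<close>

lemma htpy1_bdry2:
  assumes "g \<in> carrier R"
  shows "(\<Sum>a\<in>A. htpy1 a (g \<star> bdry2 a)) = g"
proof (rule carrier_R_eqI[OF assms])
  fix x z assume x: "x \<in> lists A" and z: "z \<in> lists A"
  let ?n = "nf (cl x)"
  have "(\<Sum>a\<in>A. htpy1 a (gen x z \<star> bdry2 a)) = trace (?n @ u) z - trace (?n @ v) z"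
    using x z u v by (simp add: gen_prod_bdry2 htpy_diff sum_subtractf htpy1_fox)
  \<comment> \<open>The two traces differ by the single step that replaces \<open>u\<close> by
    \<open>v\<close> behind \<open>?n\<close>.\<close>
  also have "\<dots> = gen ?n z"
    using trace_path[of "?n @ u" "[(?n, True, [])]" "?n @ v" z] nf_cl[OF x] u by (simp add: relator_def)
  also have "\<dots> = gen x z" using nf_cl[OF x] by (intro gen_cong) auto
  finally show "(\<Sum>a\<in>A. htpy1 a (gen x z \<star> bdry2 a)) = gen x z" .
qed (simp_all add: prod_distrib htpy_diff sum_subtractf)

text \<open>The homotopy identity in degree 1, one matrix entry at a time. The Fox derivatives of
  the representative of \<open>x a\<close> cancel, and the Leibniz rule leaves the derivative of the
  last letter.\<close>

lemma htpy0_bdry1: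
  assumes "g \<in> carrier R" "a \<in> A"
  shows "htpy0 a' (g \<star> bdry1 a) + htpy1 a g \<star> bdry2 a' = (if a = a' then g else 0)"
proof (rule carrier_R_eqI[OF assms(1)])
  fix x z assume x: "x \<in> lists A" and z: "z \<in> lists A"
  let ?n = "nf (cl x)"
  have n: "?n @ [a] \<in> lists A" using nf_cl[OF x] assms(2) by auto
  have xa: "cl (?n @ [a]) = cl (x @ [a])"
    using x assms(2) nf_cl by (intro cl_append_cong) auto
  obtain ss where ss: "path u v (?n @ [a]) ss (nf (cl (x @ [a])))"
    using ex_path_nf[OF n] xa by auto
  have "htpy1 a (gen x z) \<star> bdry2 a' = fox a' [] (?n @ [a]) z - fox a' [] (nf (cl (x @ [a]))) z"
    using x z trace_eq[of "?n @ [a]" ss z] ss xa path_sum_bdry2[OF ss n z, of a'] by (simp add: htpy1_gen)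
  moreover have "htpy0 a' (gen x z \<star> bdry1 a) = fox a' [] (nf (cl (x @ [a]))) z - fox a' [] ?n (a # z)"
    using x z assms(2) by (simp add: gen_prod_bdry1 htpy_diff htpy0_gen)
  moreover have "gen ?n z = gen x z" using nf_cl[OF x] by (intro gen_cong) auto
  ultimately show "htpy0 a' (gen x z \<star> bdry1 a) + htpy1 a (gen x z) \<star> bdry2 a' = (if a = a' then gen x z else 0)"
    by (simp add: fox_append)
qed (auto simp: prod_distrib htpy_diff)

text \<open>By \<open>fox_bdry1\<close> this is a difference of terms in which \<open>u\<close> and
  \<open>v\<close> occur only through their common class.\<close>

lemma bdry2_bdry1: "(\<Sum>a\<in>A. g \<star> bdry2 a \<star> bdry1 a) = 0" if "g \<in> carrier R"
proof -
  have "(\<Sum>a\<in>A. g \<star> bdry2 a \<star> bdry1 a) = (\<lambda>_. 0) g"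
  proof (rule carrier_R_eqI[OF that])
    fix x z assume x: "x \<in> lists A" and z: "z \<in> lists A"
    have "gen (x @ u) z = gen (x @ v) z" "gen x (u @ z) = gen x (v @ z)"
      using cl_relation[of x "[]"] cl_relation[of "[]" z] by (auto intro: gen_cong)
    then show "(\<Sum>a\<in>A. gen x z \<star> bdry2 a \<star> bdry1 a) = 0"
      using x z u v by (simp add: gen_prod_bdry2 prod_distrib sum_subtractf fox_bdry1)
  qed (simp_all add: prod_distrib sum_subtractf)
  then show ?thesis by simp
qed

text \<open>The multiplication map from ZM \<otimes> ZM to ZM. Written as the action on the unit, it
  is linear by associativity of the action.\<close>

definition augm :: "('a list set \<times> 'a list set \<Rightarrow>\<^sub>0 int) \<Rightarrow> ('a list set \<Rightarrow>\<^sub>0 int)" where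
  "augm g = g \<odot>\<^bsub>bimodule_ZM M\<^esub> frag_of (cl [])"

lemma augm_gen: "x \<in> lists A \<Longrightarrow> z \<in> lists A \<Longrightarrow> augm (gen x z) = frag_of (cl (x @ z))"
  by (simp add: augm_def gen_def bimodule_ZM_def pres_class_mult)

lemma augm_diff: "augm (f - g) = augm f - augm g" and augm_0: "augm 0 = 0"
  and augm_add: "augm (f + g) = augm f + augm g"
  by (simp_all add: augm_def bimodule_ZM_def biext_diff_left biext_add_left)

text \<open>The additive section sending m to 1 \<otimes> m, the start of the homotopy.\<close>

definition section0 :: "('a list set \<Rightarrow>\<^sub>0 int) \<Rightarrow> ('a list set \<times> 'a list set \<Rightarrow>\<^sub>0 int)" where
  "section0 = frag_extend (\<lambda>m. frag_of (cl [], m))"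

lemma section0_of: "section0 (frag_of (cl w)) = gen [] w"
  by (simp add: section0_def gen_def)

text \<open>The homotopy identity in degree 0: with n the representative of x, the Fox formula gives
  n \<otimes> z - 1 \<otimes> n z, and the section restores the second term.\<close>

lemma htpy0_augm:
  assumes "g \<in> carrier R"
  shows "(\<Sum>a\<in>A. htpy0 a g \<star> bdry1 a) + section0 (augm g) = g"
proof (rule carrier_R_eqI[OF assms])
  fix x z assume x: "x \<in> lists A" and z: "z \<in> lists A"
  let ?n = "nf (cl x)"
  have "gen ?n z = gen x z" using nf_cl[OF x] by (intro gen_cong) auto
  moreover have "cl (?n @ z) = cl (x @ z)" using nf_cl[OF x] x z by (intro cl_append_cong) auto
  ultimately show "(\<Sum>a\<in>A. htpy0 a (gen x z) \<star> bdry1 a) + section0 (augm (gen x z)) = gen x z"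
    using x z nf_cl[OF x] gen_cong[of "[]" "[]" "?n @ z" "x @ z"]
    by (simp add: htpy0_gen fox_bdry1 augm_gen section0_of)
qed (simp_all add: prod_distrib htpy_diff sum_subtractf augm_diff section0_def frag_extend_diff)

lemma augm_bdry1: "augm (g \<star> bdry1 a) = 0" if "g \<in> carrier R" "a \<in> A"
proof -
  have "augm (g \<star> bdry1 a) = (\<lambda>_. 0) g"
    by (rule carrier_R_eqI[OF that(1)])
      (use that in \<open>auto simp: prod_distrib augm_diff augm_gen gen_prod_bdry1\<close>)
  then show ?thesis by simp
qed

declare split_paired_All [simp del]

subsection \<open>Matrices over the bimonoid ring\<close>

text \<open>Homomorphisms of left modules multiply row vectors by a matrix from the right.
  Coordinates outside \<open>B'\<close> are zero, as \<open>free_on\<close> requires.\<close>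

definition matrix_map :: "'a index set \<Rightarrow> 'a index set \<Rightarrow>
    ('a index \<Rightarrow> 'a index \<Rightarrow> ('a list set \<times> 'a list set \<Rightarrow>\<^sub>0 int)) \<Rightarrow>
    ('a index \<Rightarrow> ('a list set \<times> 'a list set \<Rightarrow>\<^sub>0 int)) \<Rightarrow>
    'a index \<Rightarrow> ('a list set \<times> 'a list set \<Rightarrow>\<^sub>0 int)" where
  "matrix_map B B' C f = (\<lambda>q. if q \<in> B' then \<Sum>p\<in>B. f p \<star> C p q else 0)"

lemma free_on_R:
  assumes "finite B"
  shows "carrier (free_on R B) = {f. (\<forall>x. f x \<in> carrier R) \<and> (\<forall>x. x \<notin> B \<longrightarrow> f x = 0)}"
  by (simp add: carrier_free_on_finite[OF assms] R_simps)

lemma free_on_R_ops: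
  "f \<oplus>\<^bsub>free_on R B\<^esub> g = (\<lambda>x. f x + g x)" "r \<odot>\<^bsub>free_on R B\<^esub> f = (\<lambda>x. r \<star> f x)"
  "\<zero>\<^bsub>free_on R B\<^esub> = (\<lambda>_. 0)"
  by (simp_all add: free_on_def R_simps)

lemma matrix_map_hom:
  assumes "finite B" "finite B'" "\<And>p q. p \<in> B \<Longrightarrow> q \<in> B' \<Longrightarrow> C p q \<in> carrier R"
  shows "matrix_map B B' C \<in> lmod_hom R (free_on R B) (free_on R B')"
proof -
  have "matrix_map B B' C f \<in> carrier (free_on R B')" if "f \<in> carrier (free_on R B)" for f
    using that assms by (auto simp: matrix_map_def free_on_R carrier_R_closed
        intro!: sum_in_carrier_R R.m_closed)
  moreover have "matrix_map B B' C (\<lambda>x. r \<star> f x) = (\<lambda>x. r \<star> matrix_map B B' C f x)"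
    if "f \<in> carrier (free_on R B)" "r \<in> carrier R" for f r
    using that assms by (auto simp: fun_eq_iff matrix_map_def free_on_R prod_sum prod_distrib R.m_assoc
        intro!: sum.cong)
  moreover have "matrix_map B B' C (\<lambda>x. f x + g x) = (\<lambda>x. matrix_map B B' C f x + matrix_map B B' C g x)"
    for f g
    by (auto simp: fun_eq_iff matrix_map_def prod_distrib sum.distrib)
  ultimately show ?thesis
    by (auto simp: lmod_hom_def hom_def free_on_R_ops)
qed

subsection \<open>The resolution\<close>

text \<open>A label in the prescribed index type. The set \<open>{[a]}\<close> encodes the letter
  itself rather than its class, so letters that are equal in \<open>M\<close> keep distinct
  labels.\<close>

definition letter :: "'a \<Rightarrow> 'a index" where "letter a = (0, frag_of {[a]})"

definition point :: "'a index" where "point = (0, 0)"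

abbreviation unletter where "unletter \<equiv> inv_into UNIV letter"

lemma inj_letter: "inj letter"
  by (auto simp: inj_def letter_def frag_of_eq)

definition basis_index :: "nat \<Rightarrow> 'a index set" where
  "basis_index n = (if n = 0 then {point} else if n = 1 then letter ` A else if n = 2 then {point} else {})"

text \<open>\<open>bdry n\<close> goes from degree n + 1 to degree n. The letter labels the row of
  the matrix for n = 0 and the column for n = 1.\<close>

definition bdry :: "nat \<Rightarrow> ('a index \<Rightarrow> ('a list set \<times> 'a list set \<Rightarrow>\<^sub>0 int)) \<Rightarrow>
    'a index \<Rightarrow> ('a list set \<times> 'a list set \<Rightarrow>\<^sub>0 int)" where
  "bdry n = matrix_map (basis_index (Suc n)) (basis_index n)
     (\<lambda>p q. if n = 0 then bdry1 (unletter p) else if n = 1 then bdry2 (unletter q) else 0)"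

lemma finite_basis_index: "finite (basis_index n)"
  using finite_A by (simp add: basis_index_def)

lemma bdry1_in_carrier: "a \<in> A \<Longrightarrow> bdry1 a \<in> carrier R"
  by (simp add: bdry1_def carrier_R_closed gen_in_carrier)

lemma bdry2_in_carrier: "bdry2 a \<in> carrier R"
  using u v by (simp add: bdry2_def carrier_R_closed fox_in_carrier del: in_lists_conv_set)

lemma bdry_hom: "bdry n \<in> lmod_hom R (free_on R (basis_index (Suc n))) (free_on R (basis_index n))"
  unfolding bdry_def
  by (rule matrix_map_hom[OF finite_basis_index finite_basis_index])
    (auto simp: basis_index_def bdry1_in_carrier bdry2_in_carrier carrier_R_closed inv_f_f[OF inj_letter]
      split: if_splits)

lemma bdry_0: "bdry 0 f = (\<lambda>q. if q = point then \<Sum>a\<in>A. f (letter a) \<star> bdry1 a else 0)"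
  by (auto simp: bdry_def matrix_map_def basis_index_def fun_eq_iff inv_f_f[OF inj_letter]
      sum.reindex[OF inj_on_subset[OF inj_letter subset_UNIV]])

lemma bdry_1: "bdry (Suc 0) f = (\<lambda>q. if q \<in> letter ` A then f point \<star> bdry2 (unletter q) else 0)"
  by (auto simp: bdry_def matrix_map_def basis_index_def fun_eq_iff)

lemma bdry_ge_2: "n \<ge> 2 \<Longrightarrow> bdry n f = (\<lambda>_. 0)"
  by (auto simp: bdry_def matrix_map_def basis_index_def fun_eq_iff)

lemma free_on_basis_index_ge_3: "n > 2 \<Longrightarrow> carrier (free_on R (basis_index n)) = {\<lambda>_. 0}"
  by (auto simp: free_on_R finite_A basis_index_def carrier_R_closed)

section \<open>Augmentation and exactness\<close>

lemma lmod_ker_eq: "lmod_ker N L f = {x \<in> carrier N. f x = \<zero>\<^bsub>L\<^esub>}"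
  by (simp add: lmod_ker_def kernel_def)

lemma augm_hom: "(\<lambda>f. augm (f point)) \<in> lmod_hom R (free_on R (basis_index 0)) (bimodule_ZM M)"
proof -
  interpret Z: left_module R "bimodule_ZM M"
    by (rule left_module_bimodule_ZM[OF monoid_presented_monoid])
  have "frag_of (cl []) \<in> carrier (bimodule_ZM M)"
    by (simp add: bimodule_ZM_def monoid_ring_def)
  moreover have "f \<oplus>\<^bsub>bimodule_ZM M\<^esub> g = f + g" for f g by (simp add: bimodule_ZM_def)
  ultimately show ?thesis
    using augm_add
    by (auto simp: lmod_hom_def hom_def free_on_R_ops free_on_R[OF finite_basis_index]
        augm_def Z.smult_assoc1)
qed

lemma augm_onto: "(\<lambda>f. augm (f point)) ` carrier (free_on R (basis_index 0)) = carrier (bimodule_ZM M)"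
proof
  show "(\<lambda>f. augm (f point)) ` carrier (free_on R (basis_index 0)) \<subseteq> carrier (bimodule_ZM M)"
    using augm_hom by (auto simp: lmod_hom_def hom_def)
  show "carrier (bimodule_ZM M) \<subseteq> (\<lambda>f. augm (f point)) ` carrier (free_on R (basis_index 0))"
  proof
    fix x assume "x \<in> carrier (bimodule_ZM M)"
    then have x: "Poly_Mapping.keys x \<subseteq> carrier M" by (simp add: bimodule_ZM_def monoid_ring_def)
    have "augm (section0 x) = x"
    proof (rule frag_extend_induction_eq[OF x])
      show "augm (section0 (frag_of m)) = frag_of m" if "m \<in> carrier M" for m
        using nf[OF that] section0_of[of "nf m"] augm_gen[of "[]" "nf m"] by simp
    qed (simp_all add: section0_def frag_extend_diff augm_diff)
    moreover have "section0 x \<in> carrier R"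
      using x keys_frag_extend[of "\<lambda>m. frag_of (cl [], m)" x] cl_in_carrier[of "[]"]
      unfolding carrier_R section0_def by fastforce
    ultimately show "x \<in> (\<lambda>f. augm (f point)) ` carrier (free_on R (basis_index 0))"
      by (intro image_eqI[of _ _ "\<lambda>q. if q = point then section0 x else 0"])
        (auto simp: free_on_R finite_A basis_index_def carrier_R_closed)
  qed
qed

lemma exact_0: "lmod_ker (free_on R (basis_index 0)) (bimodule_ZM M) (\<lambda>f. augm (f point))
    = bdry 0 ` carrier (free_on R (basis_index 1))"
proof (intro equalityI subsetI)
  fix f assume "f \<in> lmod_ker (free_on R (basis_index 0)) (bimodule_ZM M) (\<lambda>f. augm (f point))"
  then have f: "f point \<in> carrier R" "\<And>q. q \<noteq> point \<Longrightarrow> f q = 0" "augm (f point) = 0"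
    by (auto simp: lmod_ker_eq free_on_R finite_A basis_index_def bimodule_ZM_def)
  \<comment> \<open>The homotopy applied to \<open>f\<close> is a preimage by
    \<open>htpy0_augm\<close>, since the augmentation of \<open>f\<close> vanishes.\<close>
  let ?g = "\<lambda>q. if q \<in> letter ` A then htpy0 (unletter q) (f point) else 0"
  have g: "?g \<in> carrier (free_on R (basis_index 1))"
    using f(1) by (auto simp: free_on_R finite_A basis_index_def carrier_R_closed htpy0_in_carrier)
  have eq: "bdry 0 ?g = f"
    using f htpy0_augm[OF f(1)]
    by (auto simp: bdry_0 fun_eq_iff inv_f_f[OF inj_letter] section0_def)
  show "f \<in> bdry 0 ` carrier (free_on R (basis_index 1))" by (rule image_eqI[where f = "bdry 0" and x = ?g, OF eq[symmetric] g])
next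
  fix f assume "f \<in> bdry 0 ` carrier (free_on R (basis_index 1))"
  then obtain g where g: "g \<in> carrier (free_on R (basis_index 1))" "f = bdry 0 g" by blast
  then have "f \<in> carrier (free_on R (basis_index 0))"
    using bdry_hom[of 0] by (auto simp: lmod_hom_def hom_def)
  moreover have "augm (\<Sum>a\<in>I. g (letter a) \<star> bdry1 a) = 0" if "I \<subseteq> A" for I
    using that g(1) by (induction I rule: infinite_finite_induct)
      (auto simp: augm_0 augm_add augm_bdry1 free_on_R[OF finite_basis_index])
  ultimately show "f \<in> lmod_ker (free_on R (basis_index 0)) (bimodule_ZM M) (\<lambda>f. augm (f point))"
    by (auto simp: lmod_ker_eq g(2) bdry_0 bimodule_ZM_def)
qed

text \<open>On a cycle the first term of \<open>htpy0_bdry1\<close>, summed over all letters,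
  vanishes, so the homotopy yields a preimage. The other inclusion is
  \<open>bdry2_bdry1\<close>.\<close>

lemma exact_1: "lmod_ker (free_on R (basis_index 1)) (free_on R (basis_index 0)) (bdry 0)
    = bdry 1 ` carrier (free_on R (basis_index 2))"
proof (intro equalityI subsetI)
  fix f assume "f \<in> lmod_ker (free_on R (basis_index 1)) (free_on R (basis_index 0)) (bdry 0)"
  then have f: "\<And>q. f q \<in> carrier R" "\<And>q. q \<notin> letter ` A \<Longrightarrow> f q = 0" and b: "bdry 0 f = (\<lambda>_. 0)"
    by (auto simp: lmod_ker_eq free_on_R finite_A basis_index_def free_on_R_ops)
  have f0: "(\<Sum>a\<in>A. f (letter a) \<star> bdry1 a) = 0" using fun_cong[OF b, of point] by (simp add: bdry_0)
  have f1: "f (letter a) \<in> carrier R" for a by (rule f(1))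
  let ?g = "\<Sum>a\<in>A. htpy1 a (f (letter a))"
  have g: "(\<lambda>q. if q = point then ?g else 0) \<in> carrier (free_on R (basis_index 2))"
    using f1 by (auto simp: free_on_R finite_A basis_index_def carrier_R_closed
        intro!: sum_in_carrier_R htpy1_in_carrier)
  have "?g \<star> bdry2 a' = f (letter a')" if "a' \<in> A" for a'
  proof -
    have "htpy0 a' (\<Sum>a\<in>A. f (letter a) \<star> bdry1 a) + ?g \<star> bdry2 a'
        = (\<Sum>a\<in>A. if a = a' then f (letter a) else 0)"
      using htpy0_bdry1[OF f(1)]
      by (simp add: htpy0_sum prod_sum flip: sum.distrib)
    then show ?thesis using that finite_A by (simp add: f0 htpy_add)
  qed
  then have "bdry 1 (\<lambda>q. if q = point then ?g else 0) q = f q" for q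
    using f(2)[of q] by (cases "q \<in> letter ` A") (auto simp: bdry_1 inv_f_f[OF inj_letter])
  then have "f = bdry 1 (\<lambda>q. if q = point then ?g else 0)" by (simp add: fun_eq_iff)
  with g show "f \<in> bdry 1 ` carrier (free_on R (basis_index 2))" by blast
next
  fix f assume "f \<in> bdry 1 ` carrier (free_on R (basis_index 2))"
  then obtain g where g: "g \<in> carrier (free_on R (basis_index 2))" "f = bdry 1 g" by blast
  then have "f \<in> carrier (free_on R (basis_index 1))"
    using bdry_hom[of 1] by (auto simp: lmod_hom_def hom_def numeral_2_eq_2)
  moreover have "bdry 0 f = (\<lambda>_. 0)"
    using g(1) bdry2_bdry1[of "g point"]
    by (auto simp: g(2) bdry_0 bdry_1 fun_eq_iff inv_f_f[OF inj_letter] free_on_R[OF finite_basis_index])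
  ultimately show "f \<in> lmod_ker (free_on R (basis_index 1)) (free_on R (basis_index 0)) (bdry 0)"
    by (auto simp: lmod_ker_eq free_on_R_ops)
qed

text \<open>The homotopy recovers an element of degree 2 from its boundary by
  \<open>htpy1_bdry2\<close>.\<close>

lemma exact_2: "lmod_ker (free_on R (basis_index 2)) (free_on R (basis_index 1)) (bdry 1) = {\<lambda>_. 0}"
proof (intro equalityI subsetI)
  fix f assume "f \<in> lmod_ker (free_on R (basis_index 2)) (free_on R (basis_index 1)) (bdry 1)"
  then have f: "f point \<in> carrier R" "\<And>q. q \<noteq> point \<Longrightarrow> f q = 0" and b: "bdry 1 f = (\<lambda>_. 0)"
    by (auto simp: lmod_ker_eq free_on_R finite_A basis_index_def free_on_R_ops)
  have "f point \<star> bdry2 a = 0" if "a \<in> A" for a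
    using that fun_cong[OF b, of "letter a"] inv_f_f[OF inj_letter, of a]
    by (simp add: bdry_1)
  then have "f point = 0" using htpy1_bdry2[OF f(1)] by (simp add: htpy_add)
  then have "f q = 0" for q using f(2)[of q] by (cases "q = point") simp_all
  then show "f \<in> {\<lambda>_. 0}" by (simp add: fun_eq_iff)
qed (auto simp: lmod_ker_eq free_on_R[OF finite_basis_index] free_on_R_ops carrier_R_closed bdry_1 prod_distrib)

lemma resolution:
  "projective_resolution R (bimodule_ZM M) (\<lambda>n. free_on R (basis_index n)) bdry (\<lambda>f. augm (f point))"
  unfolding projective_resolution_def
proof (intro conjI allI)
  show "lmod_ker (free_on R (basis_index (Suc n))) (free_on R (basis_index n)) (bdry n)
      = bdry (Suc n) ` carrier (free_on R (basis_index (Suc (Suc n))))" for n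
  proof -
    consider "n = 0" | "n = 1" | "n \<ge> 2" by linarith
    then show ?thesis
    proof cases
      case 1
      then show ?thesis using exact_1 by (simp add: numeral_2_eq_2)
    next
      \<comment> \<open>The module in degree 3 is zero, so exactness in degree 2 is injectivity of
        \<open>bdry 1\<close>.\<close>
      case 2
      then show ?thesis
        using exact_2 free_on_basis_index_ge_3[of 3] by (simp add: numeral_2_eq_2 numeral_3_eq_3 bdry_ge_2)
    next
      case 3
      then show ?thesis
        using free_on_basis_index_ge_3[of "Suc n"] free_on_basis_index_ge_3[of "Suc (Suc n)"]
        by (auto simp: lmod_ker_eq bdry_ge_2 free_on_R_ops)
    qed
  qed
qed (use left_module_bimodule_ZM[OF monoid_presented_monoid] projective_module_free_on[OF ring_R]
      bdry_hom augm_hom augm_onto exact_0 in auto)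

end

theorem theorem8p1:
  fixes A :: "'a set" and u v :: "'a list"
  assumes "finite A"
    and "u \<in> lists A" and "u \<noteq> []"
    and "v \<in> lists A" and "v \<noteq> []"
    and "incompressible A u v"
  shows "type_bi_FP_infinity (one_relator_monoid A u v) \<and>
    hochschild_dimension (one_relator_monoid A u v) \<le> 2"
proof -
  interpret incompressible_presentation A u v using assms by unfold_locales
  have "type_bi_FP_infinity M"
    unfolding type_bi_FP_infinity_def type_FP_infinity_def
    using resolution fin_gen_free_on[OF ring_R finite_basis_index] by blast
  moreover have "hochschild_dimension M \<le> enat 2"
    unfolding hochschild_dimension_def projective_dimension_def
  \<comment> \<open>The same resolution shows that 2 belongs to the set whose infimum is the
    dimension.\<close>
  proof (rule Inf_lower, intro CollectI exI conjI allI impI)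
    show "projective_resolution R (bimodule_ZM M) (\<lambda>n. free_on R (basis_index n)) bdry (\<lambda>f. augm (f point))"
      by (rule resolution)
    show "carrier (free_on R (basis_index k)) = {\<zero>\<^bsub>free_on R (basis_index k)\<^esub>}" if "k > 2" for k
      using free_on_basis_index_ge_3[OF that] by (simp add: free_on_R_ops)
  qed simp
  ultimately show ?thesis by (simp add: numeral_eq_enat)
qed

end
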